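(* Suppose that $t_1\ge4$, or that $t_1=3$ and $p$ does not divide $z$. Then the critical exponent of $\mathbf u_\beta$ is $$\mathrm E(\mathbf u_\beta)=\sup_{n\in\mathbb N}\left\{t_1+\frac{|z^{(n)}|+|\varphi^n(1)|-1}{|\varphi^n(0)|}\right\},$$ and the ultimate critical exponent is $$\mathrm E^*(\mathbf u_\beta)=\begin{cases}\beta+\frac{1}{\beta^m-1}(t+\triangle_m) & \text{if } p \text{ divides } z,\\ \beta+\frac{1}{\beta^m}(t+\triangle_m) & \text{otherwise.}\end{cases}$$
   Context: Let $\beta>1$ be a non-simple Parry number: its Rényi expansion of unity $d_\beta(1)=t_1t_2t_3\cdots$ (nonnegative integers with $t_1=\lfloor\beta\rfloor$, $1=\sum_{i\ge1}t_i\beta^{-i}$, and $t_it_{i+1}\cdots\prec t_1t_2\cdots$ lexicographically for all $i\ge2$) has the form $t_1\cdots t_m(t_{m+1}\cdots t_{m+p})^\omega$ and is not of the form $t_1\cdots t_k0^\omega$, with $m,p\ge1$ least possible (so $t_m\neq t_{m+p}$). On $\mathcal A=\{0,1,\dots,m+p-1\}$ let $\varphi$ be the substitution $\varphi(k)=0^{t_{k+1}}(k+1)$ for $0\le k\le m+p-2$, $\varphi(m+p-1)=0^{t_{m+p}}m$, and $\mathbf u_\beta=\lim_n\varphi^n(0)$ its fixed point. Let $t=\min\{t_m,t_{m+p}\}$ and let $z$ be the letter $1+\max\{j: 0^j$ is a suffix of $t_{m+1}\cdots t_{m+p}t_{m+1}\cdots t_{m+p-1}\}$ if $t_m>t_{m+p}$,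 and $1+\max\{j: 0^j$ is a suffix of $t_1\cdots t_{m-1}\}$ if $t_{m+p}>t_m$ (it is the unique nonzero letter with $z0^tm$ a factor of $\mathbf u_\beta$). For $n\in\mathbb N$ write $n=\ell m+k$ with $0\le k<m$; $z^{(n)}=\epsilon$ if $n<m$; $z^{(n)}=\varphi^k(0^tm)\varphi^{k+m}(0^tm)\cdots\varphi^{(\ell-1)m+k}(0^tm)$ if $n\ge m$ and $p$ divides $z$; $z^{(n)}=\varphi^{n-m}(0^tm)$ otherwise. $\triangle_k=\sum_{i\ge1}t_{i+k}\beta^{-i}$. A word $v$ is a power of a nonempty word $w$ if $v$ is a prefix of $w^\omega$; the index of a nonempty factor $w$ in an infinite word $\mathbf u$ is $\mathrm{ind}(w)=\sup\{|v|/|w|: v \text{ a factor of }\mathbf u\text{ and a power of }w\}$. The critical exponent is $\mathrm E(\mathbf u)=\sup\{\mathrm{ind}(w): w\text{ a nonempty factor of }\mathbf u\}$; with $\mathrm{ind}_n(\mathbf u)=\max\{\mathrm{ind}(w): w\text{ a factor of length }n\}$, the ultimate critical exponent is $\mathrm E^*(\mathbf u)=\limsup_{n\to\infty}\mathrm{ind}_n(\mathbf u)$. *)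

theory Defs
  imports "HOL-Analysis.Analysis" "HOL-Library.Fun_Lexorder" "HOL-Library.Omega_Words_Fun"
    "HOL-Library.Sublist"
begin

text \<open>
  Finite words are lists, infinite words are functions on \<^typ>\<open>nat\<close>. Digit sequences \<open>t\<close> are
  indexed from 1 as in the mathematical text; the value \<open>t 0\<close> is never used.
  The word \<open>u [i \<rightarrow> j]\<close> is \<open>u i \<dots> u (j - 1)\<close>.
\<close>


subsection \<open>Indices and critical exponents of infinite words\<close>

definition is_factor :: "'a list \<Rightarrow> 'a word \<Rightarrow> bool" where
  "is_factor w u \<longleftrightarrow> (\<exists>i j. i \<le> j \<and> w = u [i \<rightarrow> j])"

definition is_power_of :: "'a list \<Rightarrow> 'a list \<Rightarrow> bool" where
  "is_power_of v w \<longleftrightarrow> w \<noteq> [] \<and> (\<exists>n. v = w\<^sup>\<omega> [0 \<rightarrow> n])"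

text \<open>Suprema are taken in \<^typ>\<open>ereal\<close>, since the index of a factor may be infinite.\<close>

definition word_index :: "'a word \<Rightarrow> 'a list \<Rightarrow> ereal" where
  "word_index u w =
     (SUP v \<in> {v. is_factor v u \<and> is_power_of v w}. ereal (real (length v) / real (length w)))"

definition critical_exponent :: "'a word \<Rightarrow> ereal" where
  "critical_exponent u = (SUP w \<in> {w. w \<noteq> [] \<and> is_factor w u}. word_index u w)"

text \<open>
  The maximum is meaningful for words over a finite alphabet, which have finitely many factors of
  each length.
\<close>

definition index_of_length :: "'a word \<Rightarrow> nat \<Rightarrow> ereal" where
  "index_of_length u n = Max (word_index u ` {w. is_factor w u \<and> length w = n})"

definition ultimate_critical_exponent :: "'a word \<Rightarrow> ereal" where
  "ultimate_critical_exponent u = limsup (index_of_length u)"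


subsection \<open>Non-simple Parry numbers\<close>

definition renyi_expansion_of_one :: "real \<Rightarrow> (nat \<Rightarrow> nat) \<Rightarrow> bool" where
  "renyi_expansion_of_one \<beta> t \<longleftrightarrow>
     int (t 1) = \<lfloor>\<beta>\<rfloor> \<and>
     (\<lambda>i. real (t (i + 1)) / \<beta> ^ (i + 1)) sums 1 \<and>
     (\<forall>i\<ge>2. less_fun (\<lambda>j. t (i + j)) (\<lambda>j. t (1 + j)))"

text \<open>\<open>t\<close> has the form \<open>t\<^sub>1 \<dots> t\<^sub>m (t\<^sub>m\<^sub>+\<^sub>1 \<dots> t\<^sub>m\<^sub>+\<^sub>p)\<^sup>\<omega>\<close>.\<close>

definition has_preperiod_period :: "(nat \<Rightarrow> nat) \<Rightarrow> nat \<Rightarrow> nat \<Rightarrow> bool" where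
  "has_preperiod_period t m p \<longleftrightarrow> m \<ge> 1 \<and> p \<ge> 1 \<and> (\<forall>i>m. t (i + p) = t i)"

definition non_simple_parry :: "real \<Rightarrow> (nat \<Rightarrow> nat) \<Rightarrow> nat \<Rightarrow> nat \<Rightarrow> bool" where
  "non_simple_parry \<beta> t m p \<longleftrightarrow>
     \<beta> > 1 \<and> renyi_expansion_of_one \<beta> t \<and>
     \<not> (\<exists>k. \<forall>i>k. t i = 0) \<and>
     has_preperiod_period t m p \<and>
     (\<forall>m' p'. has_preperiod_period t m' p' \<longrightarrow> m \<le> m' \<and> p \<le> p')"


subsection \<open>The substitution and its fixed point\<close>

definition morphism :: "('a \<Rightarrow> 'b list) \<Rightarrow> 'a list \<Rightarrow> 'b list" where
  "morphism f w = concat (map f w)"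

text \<open>
  Letters are natural numbers; only the images of the letters \<open>0, \<dots>, m + p - 1\<close> matter.
\<close>

definition parry_letter_image :: "(nat \<Rightarrow> nat) \<Rightarrow> nat \<Rightarrow> nat \<Rightarrow> nat \<Rightarrow> nat list" where
  "parry_letter_image t m p k =
     (if k + 1 < m + p then replicate (t (k + 1)) 0 @ [k + 1]
      else replicate (t (m + p)) 0 @ [m])"

definition parry_subst :: "(nat \<Rightarrow> nat) \<Rightarrow> nat \<Rightarrow> nat \<Rightarrow> nat list \<Rightarrow> nat list" where
  "parry_subst t m p = morphism (parry_letter_image t m p)"

definition limit_word :: "(nat \<Rightarrow> 'a list) \<Rightarrow> 'a word" where
  "limit_word W = (\<lambda>i. THE a. \<forall>\<^sub>F n in sequentially. i < length (W n) \<and> W n ! i = a)"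

definition u_parry :: "(nat \<Rightarrow> nat) \<Rightarrow> nat \<Rightarrow> nat \<Rightarrow> nat word" where
  "u_parry t m p = limit_word (\<lambda>n. (parry_subst t m p ^^ n) [0])"


subsection \<open>The letter \<open>z\<close>, the words \<open>z\<^sup>(\<^sup>n\<^sup>)\<close> and the numbers \<open>\<triangle>\<^sub>k\<close>\<close>

definition t_min :: "(nat \<Rightarrow> nat) \<Rightarrow> nat \<Rightarrow> nat \<Rightarrow> nat" where
  "t_min t m p = min (t m) (t (m + p))"

definition z_letter :: "(nat \<Rightarrow> nat) \<Rightarrow> nat \<Rightarrow> nat \<Rightarrow> nat" where
  "z_letter t m p =
     (if t m > t (m + p)
      then 1 + Max {j. Sublist.suffix (replicate j 0) (map t [m+1..<m+p+1] @ map t [m+1..<m+p])}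
      else 1 + Max {j. Sublist.suffix (replicate j 0) (map t [1..<m])})"

definition z_word :: "(nat \<Rightarrow> nat) \<Rightarrow> nat \<Rightarrow> nat \<Rightarrow> nat \<Rightarrow> nat list" where
  "z_word t m p n =
     (let \<phi> = parry_subst t m p; w = replicate (t_min t m p) 0 @ [m];
          l = n div m; k = n mod m
      in if n < m then []
         else if p dvd z_letter t m p then concat (map (\<lambda>j. (\<phi> ^^ (j * m + k)) w) [0..<l])
         else (\<phi> ^^ (n - m)) w)"

definition parry_delta :: "real \<Rightarrow> (nat \<Rightarrow> nat) \<Rightarrow> nat \<Rightarrow> real" where
  "parry_delta \<beta> t k = (\<Sum>i. real (t (i + 1 + k)) / \<beta> ^ (i + 1))"

end

theory Submission
  imports Defs
begin

text \<open>
  The word \<open>u\<close> is a concatenation of blocks \<open>\<phi>(u\<^sub>0)\<phi>(u\<^sub>1)\<dots>\<close>, and since every letter image contains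
  exactly one nonzero letter, its last one, the factorisation is visible locally. Hence a maximal
  repetition whose overlap contains a nonzero letter comes from a maximal repetition of smaller
  period, extended on both sides as far as the images of the mismatching letters agree. Descending
  ends at a repetition whose overlap is a power of \<open>0\<close>. If its period is also a power of \<open>0\<close>, the
  ancestor is a run of zeros, of length at most \<open>t\<^sub>1\<close>, and the extensions are bounded by \<open>|z\<^sup>(\<^sup>n\<^sup>)|\<close> on the
  left and \<open>|\<phi>\<^sup>n(1)| - 1\<close> on the right; both bounds are attained at \<open>p 0\<^bsup>t\<^sub>1\<^esup> 1\<close>. Otherwise the overlap and
  its right extension together are shorter than one period, and the left extension is at most one
  period, or two if \<open>p\<close> divides \<open>z\<close>; the exponent is thus at most 3, or 4, hence at most \<open>t\<^sub>1\<close>.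
\<close>

text \<open>The two sides of a repetition are governed by different data. To the right, images of
  letters compare like the digit tails attached to the letters, and the Parry condition says that
  \<open>0\<close> has the largest tail. To the left, images of distinct letters disagree at once,
  except for m-1 and m+p-1, whose images both end in 0^t m; in front of this common suffix stands
  the pair 0, z, one level lower. Starting from 0 and a multiple of p, the suffix appears after m
  steps, and the process restarts exactly if p divides z. This produces the product defining
  \<open>z_word\<close> and, in the limit, a geometric series in \<beta>^(-m), of which only the
  first term survives otherwise. The assumption on t_1 is the inequality 2 + c <= t_1, with c = 2 if
  p divides z and c = 1 otherwise. All values \<open>expo n\<close> are at least t_1, so repetitions
  of exponent at most t_1 affect neither the supremum nor the limsup.\<close>

lemma less_fun_nat_iff:
  fixes f g :: "nat \<Rightarrow> nat"
  shows "less_fun f g \<longleftrightarrow> (\<exists>k. f k < g k \<and> (\<forall>k'<k. f k' = g k'))"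
  by (simp add: less_fun_def)

text \<open>The combinatorics is carried out for the digits alone. \<open>t_neq\<close> carries the
  minimality of m and p, \<open>t_not_zero\<close> the fact that the expansion does not end in
  zeros, and \<open>t_one\<close> what both cases of the assumption on t_1 share.\<close>

locale parry_digits =
  fixes t :: "nat \<Rightarrow> nat" and m p :: nat
  assumes m_pos: "m \<ge> 1" and p_pos: "p \<ge> 1"
    and t_per: "i > m \<Longrightarrow> t (i + p) = t i"
    and t_neq: "t m \<noteq> t (m + p)"
    and t_lex: "i \<ge> 2 \<Longrightarrow> less_fun (\<lambda>j. t (i + j)) (\<lambda>j. t (1 + j))"
    and t_one: "t 1 \<ge> 3"
    and t_not_zero: "\<exists>i\<in>{m+1..m+p}. t i \<noteq> 0"
begin

lemma t_le: assumes "i \<ge> 1" shows "t i \<le> t 1"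
proof (cases "i = 1")
  case False
  with assms t_lex[of i] obtain k where k: "t (i+k) < t (1+k)" "\<forall>k'<k. t (i+k') = t (1+k')"
    by (auto simp: less_fun_nat_iff)
  then show ?thesis by (cases k) (auto dest: spec[of _ 0])
qed simp


subsection \<open>Letters and block lengths\<close>

definition nxt :: "nat \<Rightarrow> nat" where
  "nxt k = (if k + 1 < m + p then k + 1 else m)"

text \<open>This is |\<phi>^n(a)| for letters a < m + p. The recursion peels off the innermost
  \<phi>: \<open>len (Suc n) a\<close> measures \<phi>^n of the word \<phi>(a).\<close>

primrec len :: "nat \<Rightarrow> nat \<Rightarrow> nat" where
  "len 0 a = 1"
| "len (Suc n) a = t (a + 1) * len n 0 + len n (nxt a)"

abbreviation \<phi> :: "nat list \<Rightarrow> nat list" where "\<phi> \<equiv> parry_subst t m p"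

lemma nxt_lt [simp]: "nxt k < m + p"
  using p_pos by (auto simp: nxt_def)

lemma nxt_neq_0 [simp]: "nxt k \<noteq> 0" "nxt k > 0"
  using m_pos by (auto simp: nxt_def)

lemma nxt_0: "nxt 0 = 1"
  using m_pos p_pos by (auto simp: nxt_def)

lemma len_pos [simp]: "len n a > 0"
  by (induction n arbitrary: a) auto

lemma letter_image: "k < m + p \<Longrightarrow> parry_letter_image t m p k = replicate (t (k + 1)) 0 @ [nxt k]"
proof -
  assume "k < m + p"
  then have "k + 1 < m + p \<or> k + 1 = m + p" by auto
  then show ?thesis by (auto simp: parry_letter_image_def nxt_def)
qed

lemma subst_append: "\<phi> (xs @ ys) = \<phi> xs @ \<phi> ys"
  by (simp add: parry_subst_def morphism_def)

lemma subst_single: "k < m + p \<Longrightarrow> \<phi> [k] = replicate (t (k + 1)) 0 @ [nxt k]"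
  by (simp add: parry_subst_def morphism_def letter_image)

lemma subst_pow_append: "(\<phi> ^^ n) (xs @ ys) = (\<phi> ^^ n) xs @ (\<phi> ^^ n) ys"
  by (induction n) (auto simp: subst_append)

lemma subst_letters: "set xs \<subseteq> {..<m+p} \<Longrightarrow> set (\<phi> xs) \<subseteq> {..<m+p}"
  using m_pos
  by (auto simp: parry_subst_def morphism_def letter_image subset_iff split: if_splits)

lemma subst_pow_letters: "set xs \<subseteq> {..<m+p} \<Longrightarrow> set ((\<phi> ^^ n) xs) \<subseteq> {..<m+p}"
  by (induction n) (auto intro!: subst_letters simp del: atLeast0LessThan)

lemma sum_list_len_subst:
  "set w \<subseteq> {..<m+p} \<Longrightarrow> sum_list (map (len n) (\<phi> w)) = sum_list (map (len (Suc n)) w)"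
proof (induction w)
  case Nil
  then show ?case by (simp add: parry_subst_def morphism_def)
next
  case (Cons a w)
  have "\<phi> (a # w) = \<phi> [a] @ \<phi> w" using subst_append[of "[a]" w] by simp
  with Cons show ?case by (simp add: subst_single sum_list_replicate)
qed

lemma length_subst_pow:
  "set w \<subseteq> {..<m+p} \<Longrightarrow> length ((\<phi> ^^ n) w) = sum_list (map (len n) w)"
proof (induction n arbitrary: w)
  case 0
  show ?case by (simp add: sum_list_triv)
next
  case (Suc n)
  have "length ((\<phi> ^^ Suc n) w) = length ((\<phi> ^^ n) (\<phi> w))" by (simp only: funpow_Suc_right o_def)
  then show ?case using Suc.IH[OF subst_letters[OF Suc.prems]] sum_list_len_subst[OF Suc.prems] by (simp only:)
qed

lemma length_subst_pow_single: "a < m + p \<Longrightarrow> length ((\<phi> ^^ n) [a]) = len n a"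
  by (subst length_subst_pow) auto


subsection \<open>The fixed point and its blocks\<close>

abbreviation W :: "nat \<Rightarrow> nat list" where "W n \<equiv> (\<phi> ^^ n) [0]"
abbreviation u :: "nat \<Rightarrow> nat" where "u \<equiv> u_parry t m p"

lemma zero_lt: "0 < m + p"
  using m_pos by simp

lemma W_Suc: "\<exists>ys. ys \<noteq> [] \<and> W (Suc n) = W n @ ys"
proof -
  obtain k where k: "t 1 = Suc k" using t_one by (cases "t 1") auto
  have "\<phi> [0] = [0] @ (replicate k 0 @ [nxt 0])"
    using k subst_single[OF zero_lt] by simp
  then have *: "W (Suc n) = W n @ (\<phi> ^^ n) (replicate k 0 @ [nxt 0])"
    by (simp only: funpow_Suc_right o_def subst_pow_append)
  have "set (replicate k 0 @ [nxt 0]) \<subseteq> {..<m+p}" using m_pos by auto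
  then have "length ((\<phi> ^^ n) (replicate k 0 @ [nxt 0])) > 0"
    by (subst length_subst_pow) auto
  with * show ?thesis by blast
qed

lemma W_prefix: "n \<le> n' \<Longrightarrow> \<exists>ys. W n' = W n @ ys"
proof (induction n' rule: dec_induct)
  case (step n')
  then show ?case using W_Suc[of n'] by (metis append.assoc)
qed simp

lemma length_W_gt: "n < length (W n)"
proof (induction n)
  case (Suc n)
  obtain ys where "ys \<noteq> []" "W (Suc n) = W n @ ys" using W_Suc by blast
  then have "length (W (Suc n)) = length (W n) + length ys" "length ys > 0" by auto
  with Suc show ?case by linarith
qed simp

lemma u_eq: assumes "i < length (W n)" shows "u i = W n ! i"
proof -
  have ev: "\<forall>\<^sub>F n' in sequentially. i < length (W n') \<and> W n' ! i = W n ! i"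
  proof (rule eventually_sequentiallyI[of n])
    fix n' assume "n \<le> n'"
    then obtain ys where "W n' = W n @ ys" using W_prefix by blast
    then show "i < length (W n') \<and> W n' ! i = W n ! i" using assms by (simp add: nth_append)
  qed
  show ?thesis unfolding u_parry_def limit_word_def
  proof (rule the_equality)
    show "\<forall>\<^sub>F n' in sequentially. i < length (W n') \<and> W n' ! i = W n ! i" by (rule ev)
    fix a assume "\<forall>\<^sub>F n' in sequentially. i < length (W n') \<and> W n' ! i = a"
    with ev have "\<forall>\<^sub>F n' in sequentially. a = W n ! i"
      by eventually_elim auto
    then show "a = W n ! i" by simp
  qed
qed

lemma u_lt [simp]: "u i < m + p"
proof -
  have "i < length (W i)" by (rule length_W_gt)
  moreover have "set (W i) \<subseteq> {..<m+p}" using m_pos by (intro subst_pow_letters) auto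
  ultimately show ?thesis by (auto simp: u_eq[of i i] dest!: nth_mem)
qed

lemma u_0 [simp]: "u 0 = 0"
  using u_eq[of 0 0] by simp

lemma map_u_W: "k \<le> length (W n) \<Longrightarrow> map u [0..<k] = take k (W n)"
  by (rule nth_equalityI) (auto simp: u_eq)

text \<open>The block \<open>\<phi>(u\<^sub>k)\<close> of \<open>u\<close> starts at position \<open>P k\<close>.\<close>

definition P :: "nat \<Rightarrow> nat" where
  "P k = (\<Sum>i<k. t (u i + 1) + 1)"

lemma P_0 [simp]: "P 0 = 0"
  by (simp add: P_def)

lemma P_Suc: "P (Suc k) = P k + t (u k + 1) + 1"
  by (simp add: P_def)

lemma length_subst_u: "length (\<phi> (map u [0..<k])) = P k"
proof (induction k)
  case (Suc k)
  then show ?case by (simp add: subst_append subst_single P_Suc)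
qed (simp add: parry_subst_def morphism_def)

lemma u_block: assumes "x \<le> t (u k + 1)" shows "u (P k + x) = \<phi> [u k] ! x"
proof -
  let ?W = "W k"
  have k: "k < length ?W" by (rule length_W_gt)
  have "?W = take (Suc k) ?W @ drop (Suc k) ?W" by simp
  also have "take (Suc k) ?W = map u [0..<Suc k]" using k by (intro map_u_W[symmetric]) simp
  finally have "W (Suc k) = \<phi> (map u [0..<k]) @ \<phi> [u k] @ \<phi> (drop (Suc k) ?W)"
    by (metis append.assoc funpow.simps(2) list.simps(8,9) map_append o_apply subst_append upt_Suc_append zero_le)
  then have "W (Suc k) ! (P k + x) = \<phi> [u k] ! x" "P k + x < length (W (Suc k))"
    using assms by (auto simp: nth_append length_subst_u subst_single)
  then show ?thesis using u_eq[of "P k + x" "Suc k"] by metis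
qed

lemma u_zero: "x < t (u k + 1) \<Longrightarrow> u (P k + x) = 0"
  by (simp add: u_block subst_single nth_append)

lemma u_end: "u (P k + t (u k + 1)) = nxt (u k)"
proof -
  have "u (P k + t (u k + 1)) = (replicate (t (u k + 1)) 0 @ [nxt (u k)]) ! t (u k + 1)"
    using u_block[of "t (u k + 1)" k, OF order.refl] subst_single[OF u_lt] by metis
  also have "\<dots> = nxt (u k)" using nth_append_length[of "replicate (t (u k + 1)) 0"] by simp
  finally show ?thesis .
qed

lemma u_P_Suc: "u (P (Suc k) - 1) = nxt (u k)"
  using u_end[of k] by (simp add: P_Suc)

lemma P_less: "P k < P (Suc k)"
  by (simp add: P_Suc)

lemma P_strict_mono: "strict_mono P"
  using P_less by (rule strict_mono_Suc_iff[THEN iffD2, rule_format])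

lemma block_exists: "\<exists>k x. y = P k + x \<and> x \<le> t (u k + 1)"
proof -
  have ge: "k \<le> P k" for k using strict_mono_imp_increasing[OF P_strict_mono] .
  define k where "k = (LEAST k. y < P (Suc k))"
  have *: "y < P (Suc k)" unfolding k_def by (rule LeastI[of _ y]) (use ge[of "Suc y"] in simp)
  have "P k \<le> y"
  proof (cases k)
    case (Suc k')
    then have "\<not> y < P (Suc k')" using not_less_Least[of k' "\<lambda>k. y < P (Suc k)"] k_def by simp
    with Suc show ?thesis by simp
  qed simp
  with * show ?thesis by (intro exI[of _ k] exI[of _ "y - P k"]) (auto simp: P_Suc)
qed

lemma u_nonzero_block: assumes "u y \<noteq> 0"
  shows "\<exists>k. y = P k + t (u k + 1) \<and> u y = nxt (u k)"
proof -
  obtain k x where kx: "y = P k + x" "x \<le> t (u k + 1)" using block_exists by blast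
  with assms u_zero have "x = t (u k + 1)" by (metis le_neq_implies_less)
  with kx u_end show ?thesis by blast
qed

lemma P_zero: "u k = 0 \<Longrightarrow> u (P k) = 0"
  using u_zero[of 0 k] t_one by simp

text \<open>Block 0 has more than one letter. The strict inequality makes the descent of maximal
  matches terminate.\<close>

lemma P_gt: assumes "k \<ge> 1" shows "k < P k"
  using assms
proof (induction k rule: dec_induct)
  case base
  then show ?case using t_one P_Suc[of 0] by simp
next
  case (step k)
  then show ?case using P_less[of k] by simp
qed


subsection \<open>Iterated block boundaries\<close>

text \<open>The position in u at which \<phi>^n(u_x) starts.\<close>

definition Pn :: "nat \<Rightarrow> nat \<Rightarrow> nat" where
  "Pn n = P ^^ n"

lemma Pn_0 [simp]: "Pn 0 x = x"
  by (simp add: Pn_def)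

lemma Pn_Suc: "Pn (Suc n) x = P (Pn n x)" and Pn_Suc': "Pn (Suc n) x = Pn n (P x)"
  by (simp_all add: Pn_def funpow_swap1)

lemma Pn_strict_mono: "strict_mono (Pn n)"
proof (induction n)
  case (Suc n)
  then show ?case using P_strict_mono by (auto simp: strict_mono_def Pn_Suc)
qed (auto simp: strict_mono_def)

lemma Pn_le_iff [simp]: "Pn n x \<le> Pn n y \<longleftrightarrow> x \<le> y"
  and Pn_less_iff [simp]: "Pn n x < Pn n y \<longleftrightarrow> x < y"
  using Pn_strict_mono[of n] by (auto simp: strict_mono_less_eq strict_mono_less)

lemma P_le_iff [simp]: "P x \<le> P y \<longleftrightarrow> x \<le> y"
  and P_less_iff [simp]: "P x < P y \<longleftrightarrow> x < y"
  using P_strict_mono by (auto simp: strict_mono_less_eq strict_mono_less)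

text \<open>The step rule for zeros is a premise because the induction proving
  \<open>Pn_step\<close> has it only as an induction hypothesis.\<close>

lemma Pn_zeros: "(\<And>i. i < d \<Longrightarrow> u (x + i) = 0) \<Longrightarrow> (\<And>x. u x = 0 \<Longrightarrow> Pn n (Suc x) = Pn n x + len n 0)
  \<Longrightarrow> Pn n (x + d) = Pn n x + d * len n 0"
  by (induction d) (auto simp: algebra_simps)

lemma Pn_step: "Pn n (Suc x) = Pn n x + len n (u x)"
proof (induction n arbitrary: x)
  case (Suc n)
  let ?d = "t (u x + 1)"
  have "Pn n (P x + ?d) = Pn n (P x) + ?d * len n 0"
    by (rule Pn_zeros) (use u_zero Suc.IH in auto)
  moreover have "Pn n (Suc (P x + ?d)) = Pn n (P x + ?d) + len n (nxt (u x))"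
    by (subst Suc.IH) (simp only: u_end)
  ultimately show ?case by (simp add: Pn_Suc' P_Suc)
qed simp

lemma Pn_add_zeros:
  "(\<And>i. i < d \<Longrightarrow> u (x + i) = 0) \<Longrightarrow> Pn n (x + d) = Pn n x + d * len n 0"
  by (rule Pn_zeros) (simp_all add: Pn_step)

lemma P_match:
  assumes "\<And>i. i < d \<Longrightarrow> u (x + i) = u (y + i)"
  shows "P (x + d) - P x = P (y + d) - P y"
    and "s < P (x + d) - P x \<Longrightarrow> u (P x + s) = u (P y + s)"
proof -
  have *: "P (x + d) + P y = P (y + d) + P x \<and>
    (\<forall>s < P (x + d) - P x. u (P x + s) = u (P y + s))"
    using assms
  proof (induction d)
    case (Suc d)
    then have IH: "P (x + d) + P y = P (y + d) + P x"
      "\<And>s. s < P (x + d) - P x \<Longrightarrow> u (P x + s) = u (P y + s)" by auto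
    have eq: "u (x + d) = u (y + d)" using Suc.prems by simp
    have le: "P x \<le> P (x + d)" "P y \<le> P (y + d)" by simp_all
    have "u (P x + s) = u (P y + s)" if s: "s < P (x + Suc d) - P x" for s
    proof (cases "s < P (x + d) - P x")
      case False
      define r where "r = s - (P (x + d) - P x)"
      have r: "P x + s = P (x + d) + r" "P y + s = P (y + d) + r"
        using False le IH(1) by (auto simp: r_def)
      have "r \<le> t (u (x + d) + 1)" using s r(1) le by (auto simp: P_Suc r_def)
      with eq show ?thesis unfolding r using u_block by metis
    qed (use IH in auto)
    with IH eq show ?case by (auto simp: P_Suc)
  qed simp
  from * show "P (x + d) - P x = P (y + d) - P y"
    using P_le_iff[of x "x + d"] P_le_iff[of y "y + d"] by linarith
  from * show "s < P (x + d) - P x \<Longrightarrow> u (P x + s) = u (P y + s)" by blast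
qed

lemma Pn_match:
  assumes "\<And>i. i < d \<Longrightarrow> u (x + i) = u (y + i)"
  shows "Pn n (x + d) - Pn n x = Pn n (y + d) - Pn n y \<and>
    (\<forall>s < Pn n (x + d) - Pn n x. u (Pn n x + s) = u (Pn n y + s))"
  using assms
proof (induction n arbitrary: x y d)
  case (Suc n)
  define d' where "d' = P (x + d) - P x"
  have d': "P (x + d) = P x + d'" by (simp add: d'_def)
  have "P (y + d) = P y + d'" using P_match(1)[OF Suc.prems, of d] d'_def P_le_iff[of y "y + d"] by simp
  moreover have "u (P x + i) = u (P y + i)" if "i < d'" for i
    using P_match(2)[OF Suc.prems, of d i] that by (simp add: d'_def)
  ultimately show ?case using Suc.IH[where d = d' and x = "P x" and y = "P y"] d'
    unfolding Pn_Suc' by metis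
qed simp


subsection \<open>Aperiodicity and maximal matches\<close>

text \<open>Only m - 1 and m + p - 1 share a successor, and \<open>t_neq\<close> tells these two
  apart.\<close>

lemma letter_eqI:
  assumes "a < m + p" "b < m + p" "t (a + 1) = t (b + 1)" "nxt a = nxt b"
  shows "a = b"
proof -
  have "a + 1 < m + p \<or> a + 1 = m + p" "b + 1 < m + p \<or> b + 1 = m + p" using assms by auto
  then show ?thesis using assms t_neq by (auto simp: nxt_def)
qed

text \<open>
  An infinite match desubstitutes to one of no larger shift. For the least possible shift every
  block involved has length 1, so that \<open>0\<close> would eventually not occur.
\<close>

lemma no_infinite_match: assumes "q > 0" shows "\<exists>x\<ge>a. u x \<noteq> u (x + q)"
proof (rule ccontr)
  define Q where "Q q \<longleftrightarrow> q > 0 \<and> (\<exists>a. \<forall>x\<ge>a. u x = u (x + q))" for q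
  assume "\<not> ?thesis"
  with assms have ex: "Q q" unfolding Q_def by blast
  define r where "r = (LEAST q. Q q)"
  have r: "Q r" unfolding r_def using ex by (rule LeastI)
  then obtain k where b: "\<And>x. x \<ge> k \<Longrightarrow> u x = u (x + r)" and "r > 0" unfolding Q_def by blast
  have kb: "k \<le> P (Suc k) - 1"
    using strict_mono_imp_increasing[OF P_strict_mono, of "Suc k"] by simp
  define y where "y = P (Suc k) - 1"
  have uy: "u y = nxt (u k)" unfolding y_def by (rule u_P_Suc)
  then have "u (y + r) \<noteq> 0" using b[of y] kb nxt_neq_0 unfolding y_def by metis
  then obtain k' where k': "y + r = P k' + t (u k' + 1)" using u_nonzero_block by blast
  have yP: "y + 1 = P (Suc k)" "y + r + 1 = P (Suc k')" using k' by (simp_all add: y_def P_Suc)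
  then have kk: "P (Suc k') = P (Suc k) + r" by simp
  have "Suc k < Suc k'" using kk \<open>r > 0\<close> P_less_iff[of "Suc k" "Suc k'"] by linarith
  define r' where "r' = k' - k"
  have r': "k' = k + r'" "r' > 0" using \<open>Suc k < Suc k'\<close> by (auto simp: r'_def)
  have match: "u (Suc k + d) = u (Suc k' + d) \<and> P (Suc k' + d) = P (Suc k + d) + r" for d
  proof (induction d rule: less_induct)
    case (less d)
    have Pd: "P (Suc k' + d) = P (Suc k + d) + r"
    proof (cases d)
      case (Suc d')
      with less[of d'] show ?thesis by (simp add: P_Suc)
    qed (simp add: kk)
    let ?x = "Suc k + d" and ?y = "Suc k' + d"
    have bd: "k \<le> P ?x + i" for i
      using strict_mono_imp_increasing[OF P_strict_mono, of ?x] by simp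
    have eq: "u (P ?x + i) = u (P ?y + i)" for i
      using b[OF bd, of i] Pd by (simp add: algebra_simps)
    \<comment> \<open>A block ends at its first nonzero letter, so equal letters from the block
      starts on force equal block lengths.\<close>
    have A: "t (u ?x + 1) = t (u ?y + 1)"
      by (metis eq linorder_neqE_nat nxt_neq_0(1) u_end u_zero)
    then have B: "nxt (u ?x) = nxt (u ?y)" using eq u_end by metis
    have "u ?x = u ?y"
      by (rule letter_eqI[OF u_lt u_lt A B])
    with Pd show ?case by simp
  qed
  have "u x = u (x + r')" if "x \<ge> Suc k" for x
    using match[of "x - Suc k"] that r' by (simp add: algebra_simps)
  then have "Q r'" using r'(2) unfolding Q_def by blast
  then have "r \<le> r'" unfolding r_def by (rule Least_le)
  have step: "P x + d \<le> P (x + d)" for x d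
    by (induction d) (auto simp: P_Suc)
  \<comment> \<open>The r' blocks starting with block x have total length r <= r', and none is
    empty.\<close>
  have P1: "P (Suc x) = P x + 1" if "x \<ge> Suc k" for x
  proof -
    have xx: "P (x + r') = P x + r" using match[of "x - Suc k"] that r' by (simp add: algebra_simps)
    have "P (Suc x) + (r' - 1) \<le> P (x + r')" using step[of "Suc x" "r' - 1"] r' by simp
    with xx \<open>r \<le> r'\<close> r' have "P (Suc x) \<le> P x + 1" by linarith
    with P_less[of x] show ?thesis by linarith
  qed
  have no0: "u x \<noteq> 0" if "x \<ge> Suc k" for x
  proof
    assume "u x = 0"
    then show False using P1[OF that] t_one by (simp add: P_Suc)
  qed
  \<comment> \<open>The unbounded positions \<open>Pn n 1\<close> all carry the letter 0, against
    \<open>no0\<close>.\<close>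
  have "u 1 = 0" using u_zero[of 1 0] t_one by simp
  then have "u (Pn n 1) = 0" for n
    by (induction n) (auto simp: Pn_Suc P_zero)
  moreover have "Suc n \<le> Pn n 1" for n
  proof (induction n)
    case (Suc n)
    then show ?case using P_gt[of "Pn n 1"] by (simp add: Pn_Suc)
  qed simp
  ultimately show False using no0 by metis
qed

text \<open>The interval \<open>[a, b)\<close> is the overlap of a maximal repetition \<open>[a, b + q)\<close> of period \<open>q\<close>.\<close>

definition max_match :: "nat \<Rightarrow> nat \<Rightarrow> nat \<Rightarrow> bool" where
  "max_match q a b \<longleftrightarrow> q > 0 \<and> a \<le> b \<and> (\<forall>x. a \<le> x \<and> x < b \<longrightarrow> u x = u (x + q)) \<and>
     u b \<noteq> u (b + q) \<and> (a = 0 \<or> u (a - 1) \<noteq> u (a - 1 + q))"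

lemma max_match_exists:
  assumes "q > 0" "c \<le> d" "\<And>x. c \<le> x \<Longrightarrow> x < d \<Longrightarrow> u x = u (x + q)"
  shows "\<exists>a b. a \<le> c \<and> d \<le> b \<and> max_match q a b"
proof -
  define b where "b = (LEAST x. x \<ge> d \<and> u x \<noteq> u (x + q))"
  have b: "b \<ge> d \<and> u b \<noteq> u (b + q)"
    unfolding b_def by (rule LeastI_ex) (use no_infinite_match[OF assms(1), of d] in auto)
  have b': "u x = u (x + q)" if "d \<le> x" "x < b" for x
    using not_less_Least[of x "\<lambda>x. x \<ge> d \<and> u x \<noteq> u (x + q)"] that by (auto simp: b_def)
  define a where "a = (LEAST a. a \<le> c \<and> (\<forall>x. a \<le> x \<and> x < c \<longrightarrow> u x = u (x + q)))"
  have a: "a \<le> c \<and> (\<forall>x. a \<le> x \<and> x < c \<longrightarrow> u x = u (x + q))"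
    unfolding a_def by (rule LeastI[of _ c]) auto
  have "a = 0 \<or> u (a - 1) \<noteq> u (a - 1 + q)"
  proof (rule ccontr)
    assume *: "\<not> ?thesis"
    then have "a - 1 < (LEAST a. a \<le> c \<and> (\<forall>x. a \<le> x \<and> x < c \<longrightarrow> u x = u (x + q)))"
      unfolding a_def[symmetric] by simp
    from not_less_Least[OF this]
    have "\<not> (a - 1 \<le> c \<and> (\<forall>x. a - 1 \<le> x \<and> x < c \<longrightarrow> u x = u (x + q)))" .
    moreover have "a - 1 \<le> c" using a[THEN conjunct1] by simp
    ultimately obtain x where x: "a - 1 \<le> x" "x < c" "u x \<noteq> u (x + q)" by blast
    then have "\<not> a \<le> x" using a by blast
    with x(1) have "x = a - 1" by linarith
    with x(3) * show False by simp
  qed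
  moreover have "u x = u (x + q)" if "a \<le> x" "x < b" for x
  proof -
    consider "x < c" | "c \<le> x" "x < d" | "d \<le> x" by linarith
    then show ?thesis using a b' assms(3) that by cases blast+
  qed
  moreover have "a \<le> b" using a b assms(2) by linarith
  ultimately have "max_match q a b" using b assms(1) unfolding max_match_def by blast
  with a b show ?thesis by blast
qed

text \<open>The mismatches at a - 1 and at b stop any match with the same shift that touches [a, b].
  The common point e may be a mere boundary, so empty intervals are covered.\<close>

lemma max_match_absorb:
  assumes "max_match q a b" "\<And>x. c \<le> x \<Longrightarrow> x < d \<Longrightarrow> u x = u (x + q)"
    and "a \<le> e" "e \<le> b" "c \<le> e" "e \<le> d"
  shows "a \<le> c" "d \<le> b"
proof -
  show "d \<le> b"
  proof (rule ccontr)
    assume "\<not> d \<le> b"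
    with assms have "u b = u (b + q)" by auto
    with assms(1) show False by (simp add: max_match_def)
  qed
  show "a \<le> c"
  proof (rule ccontr)
    assume "\<not> a \<le> c"
    with assms(2)[of "a - 1"] assms(3,6) have "u (a - 1) = u (a - 1 + q)" "a \<noteq> 0" by auto
    with assms(1) show False by (simp add: max_match_def)
  qed
qed

text \<open>A nonzero letter closes its block, so x + 1 and x + q + 1 are both block boundaries, and
  the distance of their indices is the new period. The right end b + q of the repetition is the
  descent measure.\<close>

lemma max_match_desubstitute:
  assumes mm: "max_match q a b" and x: "a \<le> x" "x < b" "u x \<noteq> 0"
  shows "\<exists>q' a' b'. max_match q' a' b' \<and> a \<le> P a' \<and> P b' \<le> b \<and> P (a' + q') = P a' + q \<and> b' + q' < b + q"
proof -
  have q: "q > 0" using mm by (simp add: max_match_def)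
  have ux: "u (x + q) \<noteq> 0" using mm x by (auto simp: max_match_def)
  obtain k where k: "x = P k + t (u k + 1)" using u_nonzero_block x by blast
  obtain k' where k': "x + q = P k' + t (u k' + 1)" using u_nonzero_block ux by blast
  have xP: "x + 1 = P (Suc k)" "x + q + 1 = P (Suc k')" using k k' by (simp_all add: P_Suc)
  then have "P (Suc k) < P (Suc k')" using q by linarith
  then have kk: "k < k'" by simp
  define q' where "q' = k' - k"
  have q': "k' = k + q'" "q' > 0" using kk by (auto simp: q'_def)
  \<comment> \<open>The seed is the empty match at \<open>Suc k\<close>: the last letter of a block
    does not determine the letter it comes from, so \<open>u k\<close> and \<open>u k'\<close> may
    differ.\<close>
  obtain a' b' where ab: "a' \<le> Suc k" "Suc k \<le> b'" "max_match q' a' b'"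
    using max_match_exists[of q' "Suc k" "Suc k"] q' by auto
  have match: "u y = u (y + q')" if "a' \<le> y" "y < b'" for y
    using ab(3) that by (auto simp: max_match_def)
  have M: "P (a' + d + q') = P (a' + d) + (P (a' + q') - P a') \<and>
     (\<forall>s < P (a' + d) - P a'. u (P a' + s) = u (P (a' + q') + s))" if d: "a' + d \<le> b'" for d
  proof -
    have "u (a' + i) = u (a' + q' + i)" if "i < d" for i
      using match[of "a' + i"] that d by (simp add: algebra_simps)
    from P_match[of d, OF this] have
      *: "P (a' + d) - P a' = P (a' + q' + d) - P (a' + q')"
      "\<And>s. s < P (a' + d) - P a' \<Longrightarrow> u (P a' + s) = u (P (a' + q') + s)" by auto
    have "P a' \<le> P (a' + d)" "P (a' + q') \<le> P (a' + q' + d)" "P a' \<le> P (a' + q')" by simp_all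
    moreover have "P (a' + d + q') = P (a' + q' + d)" by (simp add: add.commute add.left_commute)
    ultimately show ?thesis using * by (intro conjI allI impI) linarith+
  qed
  have "P (Suc k + q') = P (Suc k) + (P (a' + q') - P a')"
    using M[of "Suc k - a'"] ab by simp
  then have qq: "P (a' + q') - P a' = q" using xP q' by simp
  then have qq': "P (a' + q') = P a' + q" using P_le_iff[of a' "a' + q'"] by linarith
  have "u y = u (y + q)" if "P a' \<le> y" "y < P b'" for y
  proof -
    have *: "y - P a' < P (a' + (b' - a')) - P a'" using that ab by simp
    have "u (P a' + (y - P a')) = u (P (a' + q') + (y - P a'))"
      using M[of "b' - a'"] * ab by (metis le_trans le_add_diff_inverse order.refl)
    then show ?thesis using that qq' by (simp add: algebra_simps)
  qed
  from max_match_absorb[OF mm this, of "P a'" "P b'" "P (Suc k)"]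
  have le: "a \<le> P a'" "P b' \<le> b" using x ab xP(1) by auto
  have "P (b' + q') = P b' + q" using M[of "b' - a'"] qq ab by simp
  moreover have "b' + q' < P (b' + q')" by (rule P_gt) (use q' in simp)
  ultimately show ?thesis using le ab(3) qq' by (intro exI[of _ q'] exI[of _ a'] exI[of _ b']) simp
qed

lemma max_match_ancestor:
  assumes "max_match q a b"
  shows "\<exists>n q0 a0 b0. max_match q0 a0 b0 \<and> (\<forall>x. a0 \<le> x \<and> x < b0 \<longrightarrow> u x = 0) \<and>
     a \<le> Pn n a0 \<and> Pn n b0 \<le> b \<and> Pn n (a0 + q0) = Pn n a0 + q"
  using assms
proof (induction "b + q" arbitrary: q a b rule: less_induct)
  case less
  show ?case
  proof (cases "\<forall>x. a \<le> x \<and> x < b \<longrightarrow> u x = 0")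
    case True
    then show ?thesis using less.prems
      by (intro exI[of _ 0] exI[of _ q] exI[of _ a] exI[of _ b]) auto
  next
    case False
    then obtain x where "a \<le> x" "x < b" "u x \<noteq> 0" by auto
    from max_match_desubstitute[OF less.prems this] obtain q' a' b'
      where *: "max_match q' a' b'" "a \<le> P a'" "P b' \<le> b" "P (a' + q') = P a' + q" "b' + q' < b + q" by blast
    from less.hyps[OF *(5,1)] obtain n q0 a0 b0 where
      n: "max_match q0 a0 b0" "\<forall>x. a0 \<le> x \<and> x < b0 \<longrightarrow> u x = 0"
       "a' \<le> Pn n a0" "Pn n b0 \<le> b'" "Pn n (a0 + q0) = Pn n a0 + q'" by blast
    have ab0: "a0 \<le> b0" using n(1) by (simp add: max_match_def)
    \<comment> \<open>The identity P (y + q') = P y + q is known at y = a' and needed at y =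
      \<open>Pn n a0\<close>; the match between these points transports it.\<close>
    define d where "d = Pn n a0 - a'"
    have d: "Pn n a0 = a' + d" using n(3) by (simp add: d_def)
    have "Pn n a0 \<le> Pn n b0" using ab0 by simp
    then have dlt: "a' + d \<le> b'" using n(4) d by simp
    have "u (a' + i) = u (a' + q' + i)" if "i < d" for i
      using *(1) that dlt by (auto simp: max_match_def algebra_simps)
    from P_match(1)[of d, OF this] have "P (a' + d) - P a' = P (a' + q' + d) - P (a' + q')" by auto
    moreover have "P a' \<le> P (a' + d)" "P (a' + q') \<le> P (a' + q' + d)" by simp_all
    moreover have "P (a' + d + q') = P (a' + q' + d)" by (simp add: add.commute add.left_commute)
    ultimately have "P (Pn n a0 + q') = P (Pn n a0) + q"
      using *(4) unfolding d by linarith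
    moreover have "a \<le> P (Pn n a0)" using *(2) n(3) P_le_iff[of a' "Pn n a0"] by linarith
    moreover have "P (Pn n b0) \<le> b" using *(3) n(4) P_le_iff[of "Pn n b0" b'] by linarith
    ultimately show ?thesis using n
      by (intro exI[of _ "Suc n"] exI[of _ q0] exI[of _ a0] exI[of _ b0]) (simp add: Pn_Suc)
  qed
qed


subsection \<open>Lexicographic comparison of letters\<close>

text \<open>Letters are ordered by the tails t_(c+1) t_(c+2) ... of the digit sequence, which record
  the runs of zeros met when \<phi> is iterated on the letter.\<close>

definition lexge :: "nat \<Rightarrow> nat \<Rightarrow> bool" where
  "lexge c b \<longleftrightarrow> (\<forall>i. t (c + 1 + i) = t (b + 1 + i)) \<or> less_fun (\<lambda>i. t (b + 1 + i)) (\<lambda>i. t (c + 1 + i))"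

text \<open>The wrap from m + p - 1 back to m is invisible in the tails because of the period p, so
  \<open>nxt\<close> acts on them as the shift.\<close>

lemma nxt_seq: assumes "a < m + p" shows "t (nxt a + 1 + i) = t (a + 2 + i)"
proof (cases "a + 1 < m + p")
  case False
  with assms have "a + 1 = m + p" by simp
  then have "a + 2 + i = (m + 1 + i) + p" by simp
  then show ?thesis using False t_per[of "m + 1 + i"] by (simp add: nxt_def add_ac)
qed (simp add: nxt_def)

lemma lexge_0: "lexge 0 b"
proof (cases "b = 0")
  case False
  then show ?thesis using t_lex[of "b + 1"] by (simp add: lexge_def)
qed (simp add: lexge_def)

lemma lexge_cases:
  assumes "lexge c b"
  shows "t (b + 1) < t (c + 1) \<or> t (b + 1) = t (c + 1) \<and>
    ((\<forall>i. t (c + 2 + i) = t (b + 2 + i)) \<or> less_fun (\<lambda>i. t (b + 2 + i)) (\<lambda>i. t (c + 2 + i)))"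
  using assms unfolding lexge_def
proof
  assume *: "\<forall>i. t (c + 1 + i) = t (b + 1 + i)"
  have "t (c + 2 + i) = t (b + 2 + i)" for i using *[rule_format, of "Suc i"] by simp
  with *[rule_format, of 0] show ?thesis by simp
next
  assume "less_fun (\<lambda>i. t (b + 1 + i)) (\<lambda>i. t (c + 1 + i))"
  then obtain k where k: "t (b + 1 + k) < t (c + 1 + k)" "\<And>k'. k' < k \<Longrightarrow> t (b + 1 + k') = t (c + 1 + k')"
    by (auto simp: less_fun_nat_iff)
  show ?thesis
  proof (cases k)
    case (Suc k0)
    have "t (b + 2 + k0) < t (c + 2 + k0)" using k(1) Suc by simp
    moreover have "t (b + 2 + i) = t (c + 2 + i)" if "i < k0" for i
      using k(2)[of "Suc i"] Suc that by simp
    ultimately show ?thesis using k(2)[of 0] Suc by (auto simp: less_fun_nat_iff)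
  qed (use k in simp)
qed

lemma lexge_nxt:
  assumes "lexge c b" "c < m + p" "b < m + p" "t (b + 1) = t (c + 1)"
  shows "lexge (nxt c) (nxt b)"
proof -
  have "(\<forall>i. t (c + 2 + i) = t (b + 2 + i)) \<or> less_fun (\<lambda>i. t (b + 2 + i)) (\<lambda>i. t (c + 2 + i))"
    using lexge_cases[OF assms(1)] assms(4) by (metis less_irrefl)
  then show ?thesis unfolding lexge_def by (simp only: nxt_seq assms)
qed

lemma lexge_head: "lexge c b \<Longrightarrow> t (b + 1) \<le> t (c + 1)"
  using lexge_cases[of c b] by linarith

text \<open>At the first differing digit the larger letter has a further 0, whose image is at least
  as long as that of any letter.\<close>

lemma len_lexge: "lexge c b \<Longrightarrow> c < m + p \<Longrightarrow> b < m + p \<Longrightarrow> len n b \<le> len n c"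
proof (induction n arbitrary: b c)
  case (Suc n)
  show ?case
  proof (cases "t (b + 1) = t (c + 1)")
    case True
    then show ?thesis using Suc.IH[OF lexge_nxt[OF Suc.prems(1-3) True]] by simp
  next
    case False
    then have "t (b + 1) + 1 \<le> t (c + 1)" using lexge_head[OF Suc.prems(1)] by simp
    then have "(t (b + 1) + 1) * len n 0 \<le> t (c + 1) * len n 0" by (rule mult_le_mono1)
    moreover have "len n (nxt b) \<le> len n 0" using Suc.IH[OF lexge_0] zero_lt by simp
    ultimately show ?thesis by simp
  qed
qed simp

lemma len_le_0: "b < m + p \<Longrightarrow> len n b \<le> len n 0"
  using len_lexge[OF lexge_0] zero_lt by simp

lemma len_le_1:
  assumes "a < m + p" "t (a + 1) = t 1" shows "len n (nxt a) \<le> len n 1"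
proof -
  have "lexge (nxt 0) (nxt a)"
    using lexge_nxt[OF lexge_0[of a]] assms zero_lt by simp
  from len_lexge[OF this nxt_lt nxt_lt] show ?thesis by (simp only: nxt_0)
qed

lemma len_mono_Suc: "len n a \<le> len (Suc n) a"
proof (induction n arbitrary: a)
  case (Suc n)
  have "t (a + 1) * len n 0 \<le> t (a + 1) * len (Suc n) 0" using Suc.IH by (rule mult_le_mono2)
  then show ?case using Suc.IH[of "nxt a"] by (simp only: len.simps(2)[of n a] len.simps(2)[of "Suc n" a])
qed simp

lemma len_mono: "n \<le> n' \<Longrightarrow> len n a \<le> len n' a"
  by (rule lift_Suc_mono_le[of "\<lambda>n. len n a", OF len_mono_Suc])

lemma len_0_less: "len n 0 < len (Suc n) 0"
proof -
  have "1 * len n 0 \<le> t (0 + 1) * len n 0" using t_one by (intro mult_le_mono1) simp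
  then show ?thesis using len_pos[of n "nxt 0"] unfolding len.simps by linarith
qed

text \<open>\<phi>^i(a) ends with the letter a + i.\<close>

lemma len_shift: "a + i < m + p \<Longrightarrow> len k (a + i) \<le> len (k + i) a"
proof (induction i arbitrary: a)
  case (Suc i)
  then have "nxt a = a + 1" by (simp add: nxt_def)
  moreover have "len k (a + 1 + i) \<le> len (k + i) (a + 1)" using Suc.IH[of "a + 1"] Suc.prems by simp
  ultimately show ?case by simp
qed simp


subsection \<open>Right extensions\<close>

lemma Pn_block_zeros:
  "e \<le> t (u x + 1) \<Longrightarrow> Pn n (P x + e) = Pn n (P x) + e * len n 0"
  by (rule Pn_add_zeros) (rule u_zero, simp)

lemma block_zeros_match:
  assumes "e \<le> t (u x + 1)" "e \<le> t (u y + 1)" "s < e * len n 0"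
  shows "u (Pn n (P x) + s) = u (Pn n (P y) + s)"
proof -
  have "u (P x + i) = u (P y + i)" if "i < e" for i
    using that assms u_zero[of i x] u_zero[of i y] by simp
  from Pn_match[of e, OF this] show ?thesis using assms Pn_block_zeros[OF assms(1)] by simp
qed

text \<open>\<phi>^n(u_y) without its last letter is a prefix of \<phi>^n(u_x) when u_x has the
  larger tail; the strict bound on s + 1 leaves out that last letter.\<close>

lemma right_match:
  assumes "lexge (u x) (u y)" "s + 1 < len n (u y)"
  shows "u (Pn n x + s) = u (Pn n y + s)"
  using assms
proof (induction n arbitrary: x y s)
  case (Suc n)
  let ?e = "t (u y + 1)"
  have le: "?e \<le> t (u x + 1)" using lexge_head Suc.prems by simp
  show ?case
  proof (cases "s < ?e * len n 0")
    case True
    then show ?thesis using block_zeros_match[OF le order.refl] by (simp add: Pn_Suc')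
  next
    case False
    define s' where "s' = s - ?e * len n 0"
    have s: "s = ?e * len n 0 + s'" using False by (simp add: s'_def)
    have uy: "u (P y + ?e) = nxt (u y)" by (rule u_end)
    have "lexge (u (P x + ?e)) (u (P y + ?e))"
    proof (cases "?e = t (u x + 1)")
      case True
      then show ?thesis using lexge_nxt[OF Suc.prems(1)] u_end[of x] uy by simp
    next
      case False
      with le have "u (P x + ?e) = 0" by (intro u_zero) simp
      then show ?thesis by (simp add: lexge_0)
    qed
    moreover have "s' + 1 < len n (u (P y + ?e))" using Suc.prems(2) uy s by simp
    ultimately have "u (Pn n (P x + ?e) + s') = u (Pn n (P y + ?e) + s')" by (rule Suc.IH)
    then show ?thesis
      using Pn_block_zeros[OF le, of n] Pn_block_zeros[of ?e y n] s by (simp add: Pn_Suc' add.assoc)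
  qed
qed simp

text \<open>Neither image is a prefix of the other: after the shorter run of zeros two distinct
  letters face each other again, either two successors or a successor and a 0.\<close>

lemma right_mismatch:
  assumes "u x \<noteq> u y"
  shows "\<exists>r. r < len n (u x) \<and> r < len n (u y) \<and> u (Pn n x + r) \<noteq> u (Pn n y + r)"
  using assms
proof (induction n arbitrary: x y)
  case (Suc n)
  have main: "\<exists>r. r < len (Suc n) (u x) \<and> r < len (Suc n) (u y) \<and> u (Pn (Suc n) x + r) \<noteq> u (Pn (Suc n) y + r)"
    if ne: "u x \<noteq> u y" and le: "t (u y + 1) \<le> t (u x + 1)" for x y
  proof -
    let ?e = "t (u y + 1)" and ?d = "t (u x + 1)"
    have uy: "u (P y + ?e) = nxt (u y)" by (rule u_end)
    have ux: "u (P x + ?e) = (if ?e = ?d then nxt (u x) else 0)"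
      using u_end[of x] u_zero[of ?e x] le by auto
    have "u (P x + ?e) \<noteq> u (P y + ?e)"
      using ne letter_eqI[of "u x" "u y"] unfolding ux uy by auto
    from Suc.IH[OF this] obtain r where r: "r < len n (u (P x + ?e))" "r < len n (u (P y + ?e))"
      "u (Pn n (P x + ?e) + r) \<noteq> u (Pn n (P y + ?e) + r)" by blast
    have "?e * len n 0 + len n (u (P x + ?e)) \<le> len (Suc n) (u x)"
    proof (cases "?e = ?d")
      case False
      then have "(?e + 1) * len n 0 \<le> ?d * len n 0" using le by (intro mult_le_mono1) simp
      with False show ?thesis unfolding ux by simp
    next
      case True
      with ux have "u (P x + ?e) = nxt (u x)" by simp
      then show ?thesis unfolding True by simp
    qed
    then show ?thesis
      using r uy Pn_block_zeros[OF le, of n] Pn_block_zeros[of ?e y n]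
      by (intro exI[of _ "?e * len n 0 + r"]) (simp add: Pn_Suc' add.assoc)
  qed
  show ?case
  proof (cases "t (u y + 1) \<le> t (u x + 1)")
    case False
    then show ?thesis using main[of y x] Suc.prems by (metis linear)
  qed (use main Suc.prems in blast)
qed (use assms in auto)


subsection \<open>The letter \<open>z\<close>\<close>

abbreviation z :: nat where "z \<equiv> z_letter t m p"
abbreviation tm :: nat where "tm \<equiv> t_min t m p"

text \<open>The letter whose image is the shorter of the two images ending with \<open>m\<close>.\<close>

definition short_letter :: nat where
  "short_letter = (if t m > t (m + p) then m + p - 1 else m - 1)"

text \<open>For s different from 0 no occurrence is at position 0, since u starts with 0, so k - 1
  is a true predecessor.\<close>

definition preceded_by :: "nat \<Rightarrow> nat \<Rightarrow> bool" where
  "preceded_by s j \<longleftrightarrow> (\<forall>k. u k = s \<longrightarrow> u (k - 1) = j)"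

lemma preceded_by_0:
  assumes "s \<noteq> 0" "\<And>a. a < m + p \<Longrightarrow> nxt a = s \<Longrightarrow> t (a + 1) > 0"
  shows "preceded_by s 0"
  unfolding preceded_by_def
proof (intro allI impI)
  fix k assume "u k = s"
  with assms(1) u_nonzero_block[of k] obtain k0 where k0: "k = P k0 + t (u k0 + 1)" "nxt (u k0) = s" by auto
  with assms(2)[of "u k0"] have "t (u k0 + 1) > 0" by simp
  with k0 u_zero[of "t (u k0 + 1) - 1" k0] show "u (k - 1) = 0" by simp
qed

text \<open>If t_(s+1) = 0, then \<phi>(s) is a single letter, so the letter in front of it is the
  last letter of \<phi>(j).\<close>

lemma preceded_by_Suc:
  assumes "Suc s \<noteq> m" "Suc s < m + p" "t (Suc s) = 0" "preceded_by s j" "s \<noteq> 0"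
  shows "preceded_by (Suc s) (nxt j)"
  unfolding preceded_by_def
proof (intro allI impI)
  fix k assume "u k = Suc s"
  with u_nonzero_block[of k] obtain k0 where k0: "k = P k0 + t (u k0 + 1)" "nxt (u k0) = Suc s" by auto
  with assms have u0: "u k0 = s" by (auto simp: nxt_def split: if_splits)
  with assms(5) obtain k1 where k1: "k0 = Suc k1" by (cases k0) auto
  have "u k1 = j" using assms(4) u0 k1 by (auto simp: preceded_by_def)
  moreover have "k = P (Suc k1)" using k0 u0 assms(3) k1 by simp
  ultimately show "u (k - 1) = nxt j" using u_P_Suc by blast
qed

lemma preceded_by_chain:
  assumes "preceded_by b 0" "b \<noteq> 0" "b + j < m + p"
    and "\<And>i. b < i \<Longrightarrow> i \<le> b + j \<Longrightarrow> t i = 0 \<and> i \<noteq> m"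
  shows "preceded_by (b + j) j"
  using assms
proof (induction j)
  case (Suc j)
  then have "preceded_by (b + j) j" by auto
  with Suc.prems preceded_by_Suc[of "b + j" j] have "preceded_by (Suc (b + j)) (nxt j)" by auto
  moreover have "nxt j = Suc j" using Suc.prems by (simp add: nxt_def)
  ultimately show ?case by simp
qed simp

lemma suffix_iff_drop:
  "Sublist.suffix xs ys \<longleftrightarrow> length xs \<le> length ys \<and> xs = drop (length ys - length xs) ys"
proof
  assume "length xs \<le> length ys \<and> xs = drop (length ys - length xs) ys"
  then show "Sublist.suffix xs ys" using suffix_drop by metis
qed (auto simp: suffix_def)

lemma suffix_zeros_iff:
  "Sublist.suffix (replicate j 0) (map t [a..<b]) \<longleftrightarrow> j \<le> b - a \<and> (\<forall>i. b - j \<le> i \<and> i < b \<longrightarrow> t i = 0)"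
proof -
  have "Sublist.suffix (replicate j 0) (map t [a..<b]) \<longleftrightarrow>
      j \<le> b - a \<and> replicate j 0 = drop (b - a - j) (map t [a..<b])"
    by (simp add: suffix_iff_drop)
  also have "\<dots> \<longleftrightarrow> j \<le> b - a \<and> (\<forall>i. b - j \<le> i \<and> i < b \<longrightarrow> t i = 0)"
  proof (intro conj_cong refl)
    assume j: "j \<le> b - a"
    show "replicate j 0 = drop (b - a - j) (map t [a..<b]) \<longleftrightarrow> (\<forall>i. b - j \<le> i \<and> i < b \<longrightarrow> t i = 0)"
    proof (cases "j = 0")
      case False
      with j have "drop (b - a - j) (map t [a..<b]) = map t [b-j..<b]" by (simp add: drop_map)
      moreover have "replicate j 0 = map (\<lambda>_. 0 :: nat) [b-j..<b]"
        using False j by (simp add: map_replicate_const)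
      ultimately show ?thesis by (auto simp: map_eq_conv)
    qed (use j in auto)
  qed
  finally show ?thesis .
qed

lemma Max_suffix_zeros:
  assumes "i \<in> {a..<b}" "t i \<noteq> 0" and "j = Max {j. Sublist.suffix (replicate j 0) (map t [a..<b])}"
  shows "j < b - a" "\<And>i. b - j \<le> i \<Longrightarrow> i < b \<Longrightarrow> t i = 0" "t (b - 1 - j) \<noteq> 0"
proof -
  let ?S = "{j. Sublist.suffix (replicate j 0) (map t [a..<b])}"
  have fin: "finite ?S" by (rule finite_subset[of _ "{..b-a}"]) (auto simp: suffix_zeros_iff)
  have "0 \<in> ?S" by simp
  then have jS: "j \<in> ?S" unfolding assms(3) using Max_in[OF fin] by blast
  then show z: "t i = 0" if "b - j \<le> i" "i < b" for i using that by (simp add: suffix_zeros_iff)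
  have "j \<le> b - a" using jS by (simp add: suffix_zeros_iff)
  moreover have "j \<noteq> b - a" using z[of i] assms(1,2) by auto
  ultimately show lt: "j < b - a" by simp
  show "t (b - 1 - j) \<noteq> 0"
  proof
    assume *: "t (b - 1 - j) = 0"
    have "t i = 0" if "b - Suc j \<le> i" "i < b" for i
    proof (cases "i = b - 1 - j")
      case False
      with that have "b - j \<le> i" by linarith
      with z that show ?thesis by simp
    qed (use * in simp)
    with lt have "Suc j \<in> ?S" by (simp add: suffix_zeros_iff)
    with fin have "Suc j \<le> j" unfolding assms(3) by (intro Max_ge) auto
    then show False by simp
  qed
qed

lemma m_ge_2: "t m < t (m + p) \<Longrightarrow> m \<ge> 2"
  using t_le[of "m + p"] m_pos by (cases "m = 1") auto

text \<open>The number of trailing zeros of t_1 ... t_(m-1) is z - 1. The letter m - z is preceded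
  by 0, and each of the zeros raises letter and predecessor by one. Applying \<phi> once more puts z
  in front of 0^t m.\<close>

lemma z_letter_less:
  assumes "t m < t (m + p)"
  shows "z \<ge> 1 \<and> z < m \<and> preceded_by (m - 1) (z - 1)"
proof -
  define j where "j = Max {j. Sublist.suffix (replicate j 0) (map t [1..<m])}"
  have m2: "m \<ge> 2" using m_ge_2 assms .
  have "1 \<in> {1..<m}" "t 1 \<noteq> 0" using m2 t_one by auto
  note j = Max_suffix_zeros[OF this j_def]
  have "preceded_by (m - 1 - j) 0"
  proof (rule preceded_by_0)
    fix a assume "a < m + p" "nxt a = m - 1 - j"
    then have "a + 1 = m - 1 - j" using m2 by (auto simp: nxt_def split: if_splits)
    then show "0 < t (a + 1)" using j(3) by simp
  qed (use j(1) in simp)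
  then have "preceded_by (m - 1 - j + j) j"
  proof (rule preceded_by_chain)
    fix i assume "m - 1 - j < i" "i \<le> m - 1 - j + j"
    then show "t i = 0 \<and> i \<noteq> m" using j(1) j(2)[of i] by simp
  qed (use j(1) p_pos in simp_all)
  moreover have "z = 1 + j" using assms by (simp add: z_letter_def j_def)
  ultimately show ?thesis using j(1) by simp
qed

lemma z_letter_greater:
  assumes "t m > t (m + p)"
  shows "z \<ge> 1 \<and> z \<le> p \<and> preceded_by (m + p - 1) (z - 1) \<and> (z = p \<longrightarrow> t (m + p) \<noteq> 0)"
proof -
  define j where "j = Max {j. Sublist.suffix (replicate j 0) (map t [m+1..<m+2*p])}"
  \<comment> \<open>By periodicity the concatenation in the definition of z is the contiguous word
    t_(m+1) ... t_(m+2p-1).\<close>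
  have "[m+1..<m+2*p] = [m+1..<m+p+1] @ [m+p+1..<m+2*p]"
  proof -
    have "m + p + 1 + (p - 1) = m + 2 * p" using p_pos by simp
    with upt_add_eq_append[of "m+1" "m+p+1" "p-1"] show ?thesis
      by (metis add_le_mono1 le_add1)
  qed
  moreover have "map t [m+p+1..<m+2*p] = map t [m+1..<m+p]"
    by (rule nth_equalityI) (use t_per[of "m + 1 + _"] in \<open>auto simp: algebra_simps\<close>)
  ultimately have zj: "z = 1 + j" using assms by (simp add: z_letter_def j_def)
  obtain i where i: "i \<in> {m+1..m+p}" "t i \<noteq> 0" using t_not_zero by blast
  \<comment> \<open>The nonzero digit is moved into the last p positions, where it limits the run of
    trailing zeros.\<close>
  define i' where "i' = (if i < m + p then i + p else i)"
  have i': "i' \<in> {m+p..<m+2*p}" "t i' \<noteq> 0" using i t_per[of i] p_pos by (auto simp: i'_def)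
  have j: "j < 2 * p - 1" "\<And>i. m + 2 * p - j \<le> i \<Longrightarrow> i < m + 2 * p \<Longrightarrow> t i = 0" "t (m + 2 * p - 1 - j) \<noteq> 0"
    using Max_suffix_zeros[of i' "m+1" "m+2*p" j, OF _ i'(2) j_def] i'(1) p_pos by auto
  have jp: "j < p"
  proof (rule ccontr)
    assume "\<not> j < p"
    then have "m + 2 * p - j \<le> i'" using i'(1) by auto
    with j(2)[of i'] i' show False by auto
  qed
  have tz: "t i = 0" if "m + p - j \<le> i" "i < m + p" "m < i" for i
    using j(2)[of "i + p"] t_per[of i] that by auto
  have "preceded_by (m + p - 1 - j) 0"
  proof (rule preceded_by_0)
    show "m + p - 1 - j \<noteq> 0" using jp m_pos by simp
    fix a assume a: "a < m + p" "nxt a = m + p - 1 - j"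
    show "t (a + 1) > 0"
    proof (cases "j = p - 1")
      \<comment> \<open>Here m + p - 1 - j = m, the one letter that ends two images, so both t_m and
        t_(m+p) have to be positive.\<close>
      case True
      then have "t (m + p) \<noteq> 0" using j(3) p_pos by (simp add: add.commute)
      then show ?thesis using a True p_pos assms by (auto simp: nxt_def split: if_splits)
          (metis Suc_lessI gr0I Suc_eq_plus1)+
    next
      case False
      moreover have "m + 2 * p - 1 - j = (m + p - 1 - j) + p" using jp by simp
      ultimately have "t (m + p - 1 - j) \<noteq> 0"
        using j(3) jp t_per[of "m + p - 1 - j"] by simp
      then show ?thesis using a False jp by (auto simp: nxt_def split: if_splits)
    qed
  qed
  then have "preceded_by (m + p - 1 - j + j) j"
    by (rule preceded_by_chain) (use jp m_pos tz in auto)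
  moreover have "t (m + p) \<noteq> 0" if "z = p"
    using j(3) zj that by (simp add: mult_2)
  ultimately show ?thesis using zj jp by simp
qed

lemma z_letter_bounds: "z \<ge> 1" "z < m + p" and short_letter_preceded: "preceded_by short_letter (z - 1)"
  and short_letter_neq_0: "short_letter \<noteq> 0"
proof -
  have "t m < t (m + p) \<or> t m > t (m + p)" using t_neq by linarith
  then show "z \<ge> 1" "z < m + p" "preceded_by short_letter (z - 1)" "short_letter \<noteq> 0"
    using z_letter_less z_letter_greater m_ge_2 m_pos p_pos by (auto simp: short_letter_def)
qed

lemma nxt_z: "nxt (z - 1) = z"
  using z_letter_bounds by (simp add: nxt_def)

text \<open>If t_m > t_(m+p), then z <= p and p | z give z = p, and then t_(m+p), which is
  \<open>tm\<close>, is nonzero. So t_m < t_(m+p), where z < m.\<close>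

lemma t_min_eq_0:
  assumes "tm = 0" "p dvd z" shows "t m < t (m + p)" "p < m"
proof -
  show *: "t m < t (m + p)"
  proof (rule ccontr)
    assume "\<not> ?thesis"
    then have g: "t m > t (m + p)" using t_neq by simp
    then have "z = p" using z_letter_greater[OF g] assms(2) by (auto dest: dvd_imp_le)
    then show False using z_letter_greater[OF g] assms(1) g by (auto simp: t_min_def)
  qed
  show "p < m" using z_letter_less[OF *] assms(2) by (auto dest: dvd_imp_le)
qed


subsection \<open>Left extensions\<close>

definition wlen :: "nat \<Rightarrow> nat" where
  "wlen n = tm * len n 0 + len n m"

text \<open>
  The images of two distinct letters end with distinct letters unless they both end with \<open>m\<close>; in
  that case they have the common suffix \<open>0\<^sup>t m\<close>, preceded by \<open>0\<close> and \<open>z\<close>, respectively.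
\<close>

primrec left_len :: "nat \<Rightarrow> nat \<Rightarrow> nat \<Rightarrow> nat" where
  "left_len 0 a b = 0"
| "left_len (Suc n) a b =
     (if nxt a \<noteq> nxt b then left_len n (nxt a) (nxt b) else wlen n + left_len n 0 z)"

lemma left_len_sym: "left_len n a b = left_len n b a"
  by (induction n arbitrary: a b) auto

text \<open>Mismatching positions a and b must exist, so l is the exact length of the left
  extension, not one cut off by the start of u.\<close>

definition left_match :: "nat \<Rightarrow> nat \<Rightarrow> nat \<Rightarrow> bool" where
  "left_match x y l \<longleftrightarrow> (\<exists>a b. x = a + 1 + l \<and> y = b + 1 + l \<and> u a \<noteq> u b \<and> (\<forall>s<l. u (a + 1 + s) = u (b + 1 + s)))"

lemma left_match_sym: "left_match x y l \<Longrightarrow> left_match y x l"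
  unfolding left_match_def by metis

lemma left_match_append:
  assumes "left_match x y l" "\<And>s. s < d \<Longrightarrow> u (x + s) = u (y + s)"
  shows "left_match (x + d) (y + d) (d + l)"
proof -
  obtain a b where ab: "x = a + 1 + l" "y = b + 1 + l" "u a \<noteq> u b" "\<And>s. s < l \<Longrightarrow> u (a + 1 + s) = u (b + 1 + s)"
    using assms(1) by (auto simp: left_match_def)
  have "u (a + 1 + s) = u (b + 1 + s)" if "s < d + l" for s
  proof (cases "s < l")
    case False
    then show ?thesis using assms(2)[of "s - l"] that by (simp add: ab(1,2))
  qed (rule ab(4))
  moreover have "x + d = a + 1 + (d + l)" "y + d = b + 1 + (d + l)" by (simp_all add: ab(1,2))
  ultimately show ?thesis using ab(3) unfolding left_match_def by blast
qed

lemma same_nxt: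
  assumes "a < m + p" "b < m + p" "a \<noteq> b" "nxt a = nxt b" "t (a + 1) \<le> t (b + 1)"
  shows "nxt a = m" "nxt b = m" "a = short_letter" "t (a + 1) = tm" "tm < t (b + 1)"
proof -
  have ab: "a + 1 = m \<and> b + 1 = m + p \<or> b + 1 = m \<and> a + 1 = m + p"
    using assms(1-4) by (auto simp: nxt_def split: if_splits)
  then show "nxt a = m" "nxt b = m" using assms(4) p_pos by (auto simp: nxt_def)
  show "t (a + 1) = tm" "tm < t (b + 1)" "a = short_letter"
    using ab assms(5) t_neq p_pos by (auto simp: t_min_def short_letter_def)
qed

lemma left_match_letters:
  assumes "u x \<noteq> u y"
  shows "left_match (Pn n (Suc x)) (Pn n (Suc y)) (left_len n (u x) (u y))"
  using assms
proof (induction n arbitrary: x y)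
  case 0
  then show ?case by (auto simp: left_match_def)
next
  case (Suc n)
  have PS: "Pn (Suc n) (Suc x) = Pn n (Suc (P x + t (u x + 1)))" for x
    by (simp add: Pn_Suc' P_Suc)
  show ?case
  proof (cases "nxt (u x) = nxt (u y)")
    case False
    then have "u (P x + t (u x + 1)) \<noteq> u (P y + t (u y + 1))" by (simp only: u_end) simp
    from Suc.IH[OF this] show ?thesis using False by (simp only: PS u_end left_len.simps if_True) simp
  next
    case same: True
    have main: "left_match (Pn (Suc n) (Suc x)) (Pn (Suc n) (Suc y)) (wlen n + left_len n 0 z)"
      if xy: "u x \<noteq> u y" "nxt (u x) = nxt (u y)" "t (u x + 1) \<le> t (u y + 1)" for x y
    proof -
      note sn = same_nxt[OF u_lt u_lt xy]
      obtain x0 where x0: "x = Suc x0" using sn(3) short_letter_neq_0 by (cases x) auto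
      have "u x0 = z - 1" using short_letter_preceded sn(3) x0 by (auto simp: preceded_by_def)
      then have uz: "u (P x - 1) = z" using u_P_Suc[of x0] x0 nxt_z by simp
      have Px: "Suc (P x - 1) = P x" using P_less[of x0] unfolding x0 by linarith
      \<comment> \<open>The longer block has e > 0 zeros in front of the suffix 0^t m. The last of
        them faces z, the last letter before the shorter block, and the induction hypothesis is
        applied to this pair.\<close>
      define e where "e = t (u y + 1) - tm"
      have e: "t (u y + 1) = e + tm" "e > 0" using sn(5) by (auto simp: e_def)
      have u0: "u (P y + e - 1) = 0" using u_zero[of "e - 1" y] e sn(5) by simp
      have Py: "Suc (P y + e - 1) = P y + e" using e by simp
      have "left_match (Pn n (P x)) (Pn n (P y + e)) (left_len n z 0)"
        using Suc.IH[of "P x - 1" "P y + e - 1"] z_letter_bounds(1) unfolding uz u0 Px Py by simp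
      then have L: "left_match (Pn n (P x)) (Pn n (P y + e)) (left_len n 0 z)"
        by (subst left_len_sym)
      have m1: "u (P x + i) = 0 \<and> u (P y + e + i) = 0" if "i < tm" for i
        using u_zero[of i x] u_zero[of "e + i" y] that sn(4) e by (simp add: add.assoc)
      have m2: "u (P x + tm) = m" "u (P y + e + tm) = m"
        using u_end[of x] u_end[of y] sn e by (simp_all add: add.assoc)
      have m: "u (P x + i) = u (P y + e + i)" if "i < Suc tm" for i
        using m1[of i] m2 that by (cases "i = tm") auto
      have P1: "Pn n (P x + Suc tm) = Pn n (P x) + wlen n"
        using Pn_add_zeros[of tm "P x" n] m1 m2 by (simp add: Pn_step wlen_def)
      have P2: "Pn n (P y + e + Suc tm) = Pn n (P y + e) + wlen n"
        using Pn_add_zeros[of tm "P y + e" n] m1 m2 by (simp add: Pn_step wlen_def)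
      have "u (Pn n (P x) + s) = u (Pn n (P y + e) + s)" if "s < wlen n" for s
        using Pn_match[of "Suc tm" "P x" "P y + e" n, OF m] that P1 by simp
      from left_match_append[OF L this] show ?thesis
        using P1 P2 sn e by (simp add: PS add.assoc)
    qed
    show ?thesis
    proof (cases "t (u x + 1) \<le> t (u y + 1)")
      case True
      then show ?thesis using main[of x y] Suc.prems same by simp
    next
      case False
      then show ?thesis using left_match_sym[OF main[of y x]] Suc.prems same by simp
    qed
  qed
qed

lemma nxt_mod: "a < m + p \<Longrightarrow> nxt a mod p = Suc a mod p"
proof (cases "a + 1 < m + p")
  case False
  moreover assume "a < m + p"
  ultimately have "Suc a = m + p" by simp
  then show ?thesis by (simp add: nxt_def)
qed (simp add: nxt_def)

lemma left_len_not_cong: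
  "a < m + p \<Longrightarrow> b < m + p \<Longrightarrow> a mod p \<noteq> b mod p \<Longrightarrow> left_len n a b = 0"
proof (induction n arbitrary: a b)
  case (Suc n)
  then have "nxt a mod p \<noteq> nxt b mod p" by (auto simp: nxt_mod mod_Suc split: if_splits)
  then show ?case using Suc.IH[of "nxt a" "nxt b"] by auto
qed simp

text \<open>Both letters move on by one residue mod p per step. They first coincide when the smaller
  one reaches m, because the only letter above m - 1 congruent to it is m + p - 1.\<close>

lemma left_len_cong:
  "a < m \<Longrightarrow> a < c \<Longrightarrow> c < m + p \<Longrightarrow> a mod p = c mod p \<Longrightarrow>
   left_len n a c = (if n < m - a then 0 else wlen (n - (m - a)) + left_len (n - (m - a)) 0 z)"
proof (induction n arbitrary: a c)
  case (Suc n)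
  have na: "nxt a = Suc a" using Suc.prems by (simp add: nxt_def)
  have mod: "nxt a mod p = nxt c mod p" using Suc.prems by (simp add: nxt_mod mod_Suc)
  show ?case
  proof (cases "Suc a = m")
    case True
    have "p dvd c - a" using Suc.prems by (metis mod_eq_dvd_iff_nat less_imp_le)
    then have "p \<le> c - a" using Suc.prems by (auto dest: dvd_imp_le)
    then have "c + 1 = m + p" using True Suc.prems by simp
    then have "nxt a = m" "nxt c = m" "m - a = 1" using na True by (auto simp: nxt_def)
    then show ?thesis by simp
  next
    case False
    then have "Suc a < nxt c" using Suc.prems by (auto simp: nxt_def)
    then show ?thesis using Suc.IH[of "Suc a" "nxt c"] False Suc.prems mod na
      by (auto simp: less_diff_conv Suc_diff_Suc)
  qed
qed simp

abbreviation zlen :: "nat \<Rightarrow> nat" where "zlen n \<equiv> length (z_word t m p n)"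

lemma length_subst_pow_w: "length ((\<phi> ^^ n) (replicate tm 0 @ [m])) = wlen n"
  using p_pos m_pos by (subst length_subst_pow) (auto simp: wlen_def sum_list_replicate)

text \<open>For p | z the last factor of z^(n) is \<phi>^(n-m)(0^t m), and removing it leaves
  z^(n-m).\<close>

lemma zlen_rec:
  "zlen n = (if n < m then 0 else wlen (n - m) + (if p dvd z then zlen (n - m) else 0))"
proof (cases "n < m")
  case False
  then have d: "n div m = Suc ((n - m) div m)" and r: "n mod m = (n - m) mod m"
    using m_pos by (simp_all add: le_div_geq le_mod_geq)
  have e: "(n - m) div m * m + (n - m) mod m = n - m" by simp
  let ?f = "\<lambda>j. (\<phi> ^^ (j * m + (n - m) mod m)) (replicate tm 0 @ [m])"
  have "zlen n = length (concat (map ?f [0..<(n - m) div m])) + wlen (n - m)" if "p dvd z"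
    using False that unfolding z_word_def Let_def d r by (simp add: e length_subst_pow_w)
  moreover have "length (concat (map ?f [0..<(n - m) div m])) = zlen (n - m)" if "p dvd z"
    using that by (simp add: z_word_def Let_def)
  ultimately show ?thesis
    using False by (auto simp: z_word_def Let_def length_subst_pow_w)
qed (simp add: z_word_def Let_def)

text \<open>This identifies |z^(n)| as the left extension of 0 against any nonzero multiple of p:
  both obey the recursion of \<open>zlen_rec\<close>, which passes to the pair 0, z at level n -
  m.\<close>

lemma left_len_0:
  assumes "c \<noteq> 0" "c < m + p"
  shows "left_len n 0 c = (if p dvd c then zlen n else 0)"
  using assms
proof (induction n arbitrary: c rule: less_induct)
  case (less n)
  show ?case
  proof (cases "p dvd c")
    case False
    then show ?thesis using left_len_not_cong[of 0 c n] less.prems zero_lt by (simp add: dvd_eq_mod_eq_0)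
  next
    case True
    then have "left_len n 0 c = (if n < m then 0 else wlen (n - m) + left_len (n - m) 0 z)"
      using left_len_cong[of 0 c n] m_pos less.prems by simp
    moreover have "left_len (n - m) 0 z = (if p dvd z then zlen (n - m) else 0)" if "\<not> n < m"
      using less.IH[of "n - m" z] that m_pos z_letter_bounds by simp
    ultimately show ?thesis using True zlen_rec[of n] by auto
  qed
qed

lemma len_m_minus_1: "len (Suc k) (m - 1) = t m * len k 0 + len k m"
  using m_pos p_pos by (simp add: nxt_def)

text \<open>The word \<phi>(m-1) = 0^(t_m) m contains 0^t m, and \<phi>^(m-1)(0) ends with m - 1.
  The extra 0 is found in this run if t_m exceeds t, and otherwise among the zeros of
  \<phi>(0).\<close>

lemma len_0_add_wlen: "len k 0 + wlen k \<le> len (k + m) 0"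
proof (cases "t m < t (m + p)")
  case True
  have m2: "m \<ge> 2" using m_ge_2 True .
  define i where "i = m - 2"
  have i: "1 + i = m - 1" "k + m = Suc (k + 1 + i)" using m2 by (simp_all add: i_def)
  have "len (k + 1) (1 + i) \<le> len (k + 1 + i) 1" by (rule len_shift) (use i in simp)
  moreover have "len (k + 1) (1 + i) = t m * len k 0 + len k m"
    using len_m_minus_1[of k] unfolding i by (simp only: Suc_eq_plus1)
  moreover have "len (k + m) 0 = t 1 * len (k + 1 + i) 0 + len (k + 1 + i) 1"
    unfolding i(2) using nxt_0 by simp
  moreover have "1 * len k 0 \<le> t 1 * len (k + 1 + i) 0"
    using t_one by (intro mult_le_mono len_mono) auto
  ultimately show ?thesis using True by (simp add: wlen_def t_min_def)
next
  case False
  then have g: "tm + 1 \<le> t m" using t_neq by (auto simp: t_min_def)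
  define i where "i = m - 1"
  have i: "0 + i = m - 1" "k + m = k + 1 + i" using m_pos by (simp_all add: i_def)
  have "len (k + 1) (0 + i) \<le> len (k + 1 + i) 0" by (rule len_shift) (use i in simp)
  moreover have "len (k + 1) (0 + i) = t m * len k 0 + len k m"
    using len_m_minus_1[of k] unfolding i by (simp only: Suc_eq_plus1)
  moreover have "(tm + 1) * len k 0 \<le> t m * len k 0" using g by (rule mult_le_mono1)
  ultimately show ?thesis unfolding i(2) wlen_def by simp
qed

lemma zlen_le: "zlen n \<le> len n 0"
proof (induction n rule: less_induct)
  case (less n)
  show ?case
  proof (cases "n < m")
    case False
    then have "zlen n \<le> wlen (n - m) + zlen (n - m)" by (subst zlen_rec) simp
    moreover have "zlen (n - m) \<le> len (n - m) 0" using less[of "n - m"] False m_pos by simp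
    ultimately show ?thesis using len_0_add_wlen[of "n - m"] False by simp
  qed (subst zlen_rec, simp)
qed

lemma zlen_le_wlen: assumes "p dvd z" shows "zlen n \<le> wlen n"
proof (cases "tm = 0")
  case False
  then have "1 * len n 0 \<le> tm * len n 0" by (intro mult_le_mono1) simp
  then show ?thesis unfolding wlen_def using zlen_le[of n] by linarith
next
  case True
  note tz = t_min_eq_0[OF True assms]
  show ?thesis
  proof (cases "n < m")
    case False
    \<comment> \<open>Once around the cycle, \<phi>^p(m) ends with \<phi>(m+p-1), which contains a 0
      besides the final m; this 0 makes room for z^(n-m).\<close>
    have "Suc (n - p) + (p - 1) = n" using False tz p_pos by simp
    then have "len (Suc (n - p)) (m + (p - 1)) \<le> len n m"
      using len_shift[of m "p - 1" "Suc (n - p)"] p_pos by simp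
    moreover have "nxt (m + (p - 1)) = m" "m + (p - 1) + 1 = m + p" using p_pos by (auto simp: nxt_def)
    ultimately have "t (m + p) * len (n - p) 0 + len (n - p) m \<le> len n m"
      by (simp only: len.simps)
    moreover have "1 * len (n - p) 0 \<le> t (m + p) * len (n - p) 0"
      using tz by (intro mult_le_mono1) simp
    moreover have "len (n - m) 0 \<le> len (n - p) 0" "len (n - m) m \<le> len (n - p) m"
      using tz by (intro len_mono; simp)+
    moreover have "zlen n = len (n - m) m + zlen (n - m)"
      using False assms True by (subst zlen_rec) (simp add: wlen_def)
    moreover have "wlen n = len n m" using True by (simp add: wlen_def)
    ultimately show ?thesis using zlen_le[of "n - m"] by linarith
  qed (subst zlen_rec, simp)
qed

text \<open>
  Both \<open>\<phi>(a)\<close> and \<open>\<phi>(b)\<close> have the suffix \<open>0\<^sup>t m\<close> when they end alike, and what precedes it adds at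
  most \<open>|z\<^sup>(\<^sup>n\<^sup>)| \<le> |\<phi>\<^sup>n(0\<^sup>t m)|\<close>.
\<close>

lemma left_len_le:
  assumes "a < m + p" "b < m + p" "a \<noteq> b"
  shows "left_len n a b \<le> (if p dvd z then 2 else 1) * len n a \<and>
         left_len n a b \<le> (if p dvd z then 2 else 1) * len n b"
  using assms
proof (induction n arbitrary: a b)
  case (Suc n)
  show ?case
  proof (cases "nxt a = nxt b")
    case False
    have "(if p dvd z then 2 else 1) * len n (nxt a) \<le> (if p dvd z then 2 else 1) * len (Suc n) a" for a
      by (intro mult_le_mono2) simp
    with Suc.IH[of "nxt a" "nxt b"] False show ?thesis
      by (simp only: nxt_lt left_len.simps if_True not_False_eq_True) (meson le_trans)
  next
    case True
    have "left_len n 0 z = (if p dvd z then zlen n else 0)"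
      using left_len_0[of z n] z_letter_bounds by simp
    then have l: "left_len (Suc n) a b \<le> (if p dvd z then 2 else 1) * wlen n"
      using True zlen_le_wlen[of n] by auto
    have w: "wlen n \<le> len (Suc n) a \<and> wlen n \<le> len (Suc n) b"
      if "a < m + p" "b < m + p" "a \<noteq> b" "nxt a = nxt b" "t (a + 1) \<le> t (b + 1)" for a b
      using same_nxt[OF that] by (auto simp: wlen_def intro!: mult_le_mono1)
    have "wlen n \<le> len (Suc n) a \<and> wlen n \<le> len (Suc n) b"
      using w[of a b] w[of b a] Suc.prems True by (cases "t (a + 1) \<le> t (b + 1)") auto
    then show ?thesis using l by (meson le_trans mult_le_mono2)
  qed
qed simp


subsection \<open>Bounds for repetitions\<close>

lemma Pn_at_0 [simp]: "Pn n 0 = 0"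
  by (induction n) (simp_all add: Pn_Suc)

lemma max_match_left:
  assumes mm: "max_match q a b" and mm0: "max_match q0 a0 b0"
    and le: "a \<le> Pn n a0" "Pn n b0 \<le> b" and q: "Pn n (a0 + q0) = Pn n a0 + q" and a0: "a0 > 0"
  shows "Pn n a0 \<le> a + left_len n (u (a0 - 1)) (u (a0 - 1 + q0))"
proof -
  let ?L = "left_len n (u (a0 - 1)) (u (a0 - 1 + q0))"
  have "u (a0 - 1) \<noteq> u (a0 - 1 + q0)" using mm0 a0 by (auto simp: max_match_def)
  from left_match_letters[OF this, of n] have "left_match (Pn n a0) (Pn n (a0 + q0)) ?L"
    using a0 by simp
  then obtain x y where xy: "Pn n a0 = x + 1 + ?L" "Pn n (a0 + q0) = y + 1 + ?L" "u x \<noteq> u y"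
    by (auto simp: left_match_def)
  have y: "y = x + q" using xy q by linarith
  have "Pn n a0 \<le> Pn n b0" using mm0 by (simp add: max_match_def)
  then have "x < b" using xy(1) le by linarith
  then have "\<not> a \<le> x" using mm xy(3) y by (auto simp: max_match_def)
  then show ?thesis using xy(1) by linarith
qed

lemma max_match_right:
  assumes mm: "max_match q a b" and mm0: "max_match q0 a0 b0"
    and le: "a \<le> Pn n a0" "Pn n b0 \<le> b" and q: "Pn n (a0 + q0) = Pn n a0 + q"
  shows "b + 1 \<le> Pn n b0 + len n (u b0)" "b + 1 \<le> Pn n b0 + len n (u (b0 + q0))"
proof -
  have ab0: "a0 \<le> b0" using mm0 by (simp add: max_match_def)
  have "u (a0 + i) = u (a0 + q0 + i)" if "i < b0 - a0" for i
    using mm0 that by (auto simp: max_match_def add_ac)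
  from Pn_match[of "b0 - a0", OF this] ab0
  have "Pn n b0 - Pn n a0 = Pn n (b0 + q0) - Pn n (a0 + q0)" by (simp add: add_ac)
  moreover have "Pn n a0 \<le> Pn n b0" "Pn n (a0 + q0) \<le> Pn n (b0 + q0)" using ab0 by simp_all
  ultimately have bq: "Pn n (b0 + q0) = Pn n b0 + q" using q by linarith
  have "u b0 \<noteq> u (b0 + q0)" using mm0 by (simp add: max_match_def)
  from right_mismatch[OF this, of n] obtain r where
    r: "r < len n (u b0)" "r < len n (u (b0 + q0))" "u (Pn n b0 + r) \<noteq> u (Pn n (b0 + q0) + r)" by blast
  have "\<not> Pn n b0 + r < b"
  proof
    assume *: "Pn n b0 + r < b"
    moreover have "a \<le> Pn n b0 + r" using le \<open>Pn n a0 \<le> Pn n b0\<close> by linarith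
    ultimately have "u (Pn n b0 + r) = u (Pn n b0 + r + q)" using mm by (auto simp: max_match_def)
    with r(3) bq show False by (simp add: add_ac)
  qed
  with r show "b + 1 \<le> Pn n b0 + len n (u b0)" "b + 1 \<le> Pn n b0 + len n (u (b0 + q0))" by linarith+
qed

text \<open>Every block ends with a nonzero letter, so a run of zeros stays inside one block. If it
  has length t_1, the letter ending that block is compared with 1 = \<open>nxt 0\<close>.\<close>

lemma zero_run:
  assumes "\<And>x. a \<le> x \<Longrightarrow> x < y \<Longrightarrow> u x = 0" "u y \<noteq> 0" "a \<le> y"
  shows "y - a \<le> t 1" "y - a = t 1 \<Longrightarrow> len n (u y) \<le> len n 1"
proof -
  obtain k where k: "y = P k + t (u k + 1)" "u y = nxt (u k)" using u_nonzero_block assms(2) by blast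
  have t1: "t (u k + 1) \<le> t 1" by (rule t_le) simp
  have le: "y - a \<le> t (u k + 1)"
  proof (rule ccontr)
    assume *: "\<not> ?thesis"
    then have "k \<noteq> 0" using k by (cases k) auto
    then obtain k0 where k0: "k = Suc k0" by (cases k) auto
    have "P k > 0" using P_less[of k0] unfolding k0 by linarith
    then have "a \<le> P k - 1" "P k - 1 < y" using * k(1) by linarith+
    then have "u (P k - 1) = 0" by (rule assms(1))
    then show False using u_P_Suc[of k0] nxt_neq_0 k0 by metis
  qed
  show "y - a \<le> t 1" using le t1 by simp
  show "len n (u y) \<le> len n 1" if "y - a = t 1"
    unfolding k(2) by (rule len_le_1) (use le t1 that in auto)
qed

lemma max_match_bound:
  assumes mm: "max_match q a b" and hyp: "t 1 \<ge> 4 \<or> (t 1 = 3 \<and> \<not> p dvd z)"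
  shows "b - a + q \<le> t 1 * q \<or>
    (\<exists>n. q = len n 0 \<and> b - a + q + 1 \<le> t 1 * len n 0 + zlen n + len n 1)"
proof -
  from max_match_ancestor[OF mm] obtain n q0 a0 b0 where
    mm0: "max_match q0 a0 b0" and zero: "\<And>x. a0 \<le> x \<Longrightarrow> x < b0 \<Longrightarrow> u x = 0"
    and le: "a \<le> Pn n a0" "Pn n b0 \<le> b" and q: "Pn n (a0 + q0) = Pn n a0 + q" by blast
  have ab0: "a0 \<le> b0" "q0 > 0" "u b0 \<noteq> u (b0 + q0)"
    and per: "\<And>x. a0 \<le> x \<Longrightarrow> x < b0 \<Longrightarrow> u x = u (x + q0)"
    and lft: "a0 > 0 \<Longrightarrow> u (a0 - 1) \<noteq> u (a0 - 1 + q0)"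
    using mm0 by (auto simp: max_match_def)
  have ab: "a \<le> b" using mm by (simp add: max_match_def)
  note R = max_match_right[OF mm mm0 le q]
  have L: "Pn n a0 \<le> a + l" if "a0 > 0 \<Longrightarrow> left_len n (u (a0 - 1)) (u (a0 - 1 + q0)) \<le> l" for l
    using max_match_left[OF mm mm0 le q] that by (cases "a0 > 0") auto
  let ?U = "len n 0"
  show ?thesis
  proof (cases "\<forall>x. a0 \<le> x \<and> x < a0 + q0 \<longrightarrow> u x = 0")
    case True
    have z0: "u x = 0" if "a0 \<le> x" "x < b0 + q0" for x
    proof (cases "x < a0 + q0")
      case False
      then have "u (x - q0) = u (x - q0 + q0)" "u (x - q0) = 0"
        using per[of "x - q0"] zero[of "x - q0"] that by auto
      then show ?thesis using False by simp
    qed (use True that in auto)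
    have y: "u (b0 + q0) \<noteq> 0" using ab0 z0[of b0] by auto
    define K where "K = b0 + q0 - a0"
    have K: "K \<le> t 1" "K = t 1 \<Longrightarrow> len n (u (b0 + q0)) \<le> len n 1"
      using zero_run[of a0 "b0 + q0", OF z0 y] ab0 by (auto simp: K_def)
    have qU: "q = q0 * ?U"
      using Pn_add_zeros[of q0 a0 n] z0 q ab0 by simp
    have bU: "Pn n b0 = Pn n a0 + (b0 - a0) * ?U"
      using Pn_add_zeros[of "b0 - a0" a0 n] z0 ab0 by simp
    \<comment> \<open>The letter before the run is nonzero and faces a 0, so
      \<open>left_len_0\<close> gives z^(n) or nothing.\<close>
    have "Pn n a0 \<le> a + zlen n"
    proof (rule L)
      assume "a0 > 0"
      then have "u (a0 - 1 + q0) = 0" "u (a0 - 1) \<noteq> 0"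
        using z0[of "a0 - 1 + q0"] lft ab0 by auto
      then show "left_len n (u (a0 - 1)) (u (a0 - 1 + q0)) \<le> zlen n"
        using left_len_0[of "u (a0 - 1)" n] by (simp add: left_len_sym[of _ _ 0])
    qed
    moreover have KU: "K * ?U = (b0 - a0) * ?U + q0 * ?U"
      using ab0 by (simp add: K_def add_mult_distrib[symmetric])
    ultimately have "b - a + q + 1 \<le> K * ?U + zlen n + len n (u (b0 + q0))"
      using R(2) bU qU ab by linarith
    \<comment> \<open>A run shorter than t_1 loses at least one |\<phi>^n(0)|, which outweighs the
      image of any following letter.\<close>
    moreover have "K * ?U + len n (u (b0 + q0)) \<le> t 1 * ?U + len n 1"
    proof (cases "K = t 1")
      case False
      then have "(K + 1) * ?U \<le> t 1 * ?U" using K(1) by (intro mult_le_mono1) simp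
      then show ?thesis using len_le_0[of "u (b0 + q0)" n] by simp
    qed (use K(2) in simp)
    ultimately have main: "b - a + q + 1 \<le> t 1 * ?U + zlen n + len n 1" by linarith
    show ?thesis
    proof (cases "q0 = 1")
      case True
      then show ?thesis using main qU by auto
    next
      case False
      \<comment> \<open>For a period of at least two zeros, the crude length t_1 + 2 <= 2 t_1, in
        units of |\<phi>^n(0)|, suffices.\<close>
      have "len n 1 \<le> ?U" using len_le_0[of 1] nxt_lt[of 0] nxt_0 by simp
      then have "b - a + q \<le> (t 1 + 2) * ?U" using main zlen_le[of n] by (simp add: add_mult_distrib)
      also have "\<dots> \<le> t 1 * q0 * ?U"
      proof (rule mult_le_mono1)
        have "t 1 * 2 \<le> t 1 * q0" using False ab0 by (intro mult_le_mono2) simp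
        then show "t 1 + 2 \<le> t 1 * q0" using t_one by linarith
      qed
      finally show ?thesis using qU by (simp add: mult.assoc)
    qed
  next
    case False
    then obtain x where "a0 \<le> x" "x < a0 + q0" "u x \<noteq> 0" by auto
    then have "b0 < a0 + q0" using zero by (meson le_less_trans not_le)
    then have "Pn n (Suc b0) \<le> Pn n (a0 + q0)" by simp
    then have Rq: "b + 1 \<le> Pn n a0 + q" using R(1) q by (simp add: Pn_step)
    define c :: nat where "c = (if p dvd z then 2 else 1)"
    have c: "2 + c \<le> t 1" using hyp by (auto simp: c_def)
    have S: "Suc (a0 + q0 - 1) = a0 + q0" using ab0 by simp
    \<comment> \<open>The letter facing a0 - 1 is the last one of the first period, so its image has
      length at most q; the left extension is measured against it.\<close>
    have "Pn n a0 \<le> Pn n (a0 + q0 - 1)" using ab0 by simp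
    then have lq: "len n (u (a0 + q0 - 1)) \<le> q" using Pn_step[of n "a0 + q0 - 1"] q unfolding S by linarith
    have "Pn n a0 \<le> a + c * q"
    proof (rule L)
      assume a0: "a0 > 0"
      then have eq: "a0 - 1 + q0 = a0 + q0 - 1" by simp
      have "left_len n (u (a0 - 1)) (u (a0 - 1 + q0)) \<le> c * len n (u (a0 - 1 + q0))"
        using left_len_le[of "u (a0 - 1)" "u (a0 - 1 + q0)" n] lft[OF a0] by (auto simp: c_def)
      also have "\<dots> \<le> c * q" using lq unfolding eq by (rule mult_le_mono2)
      finally show "left_len n (u (a0 - 1)) (u (a0 - 1 + q0)) \<le> c * q" .
    qed
    then have "b - a + q \<le> (2 + c) * q" using Rq ab by (simp add: add_mult_distrib)
    also have "\<dots> \<le> t 1 * q" using c by (rule mult_le_mono1)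
    finally show ?thesis by simp
  qed
qed

lemma power_bound:
  assumes v: "is_factor v u" "is_power_of v w" and hyp: "t 1 \<ge> 4 \<or> (t 1 = 3 \<and> \<not> p dvd z)"
  shows "length v \<le> t 1 * length w \<or>
    (\<exists>n. length w = len n 0 \<and> length v + 1 \<le> t 1 * len n 0 + zlen n + len n 1)"
proof (rule disjCI)
  assume neg: "\<not> (\<exists>n. length w = len n 0 \<and> length v + 1 \<le> t 1 * len n 0 + zlen n + len n 1)"
  let ?q = "length w" and ?N = "length v"
  obtain i where i: "\<And>x. x < ?N \<Longrightarrow> v ! x = u (i + x)"
    using v(1) by (auto simp: is_factor_def)
  have w: "w \<noteq> []" "\<And>x. x < ?N \<Longrightarrow> v ! x = w ! (x mod ?q)"
    using v(2) by (auto simp: is_power_of_def iter_def)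
  show "?N \<le> t 1 * ?q"
  proof (rule ccontr)
    assume "\<not> ?thesis"
    moreover have "1 * ?q \<le> t 1 * ?q" using t_one by (intro mult_le_mono1) simp
    ultimately have qN: "?q < ?N" by linarith
    have "u x = u (x + ?q)" if "i \<le> x" "x < i + (?N - ?q)" for x
    proof -
      obtain y where y: "x = i + y" using \<open>i \<le> x\<close> le_Suc_ex by blast
      then have "y < ?N" "y + ?q < ?N" using that qN by linarith+
      then have "u (i + y) = u (i + (y + ?q))"
        using i[of y] i[of "y + ?q"] w(2)[of y] w(2)[of "y + ?q"] by simp
      then show ?thesis by (simp only: y add.assoc)
    qed
    from max_match_exists[OF _ le_add1 this] w(1) obtain a b
      where ab: "a \<le> i" "i + (?N - ?q) \<le> b" "max_match ?q a b" by blast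
    then have "?N \<le> b - a + ?q" using qN by linarith
    with max_match_bound[OF ab(3) hyp] neg \<open>\<not> ?N \<le> t 1 * ?q\<close> show False
      by (meson add_le_mono1 le_trans)
  qed
qed


subsection \<open>Long repetitions of \<open>\<phi>\<^sup>n(0)\<close>\<close>

lemma u_Pn_1: "u (Pn n 1) = 0"
proof (induction n)
  case 0
  show ?case using u_zero[of 1 0] t_one by simp
qed (simp add: Pn_Suc P_zero)

lemma u_before_Pn_1: "k < m + p \<Longrightarrow> Pn k 1 > 0 \<and> u (Pn k 1 - 1) = k"
proof (induction k)
  case (Suc k)
  then obtain y where y: "Pn k 1 = Suc y" "u y = k" by (cases "Pn k 1") auto
  have "u (Pn (Suc k) 1 - 1) = nxt k" using u_P_Suc[of y] y by (simp add: Pn_Suc)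
  moreover have "Pn (Suc k) 1 > 0" using P_less[of y] unfolding Pn_Suc y(1) by linarith
  ultimately show ?case using Suc.prems by (simp add: nxt_def)
qed simp

lemma long_match:
  "\<exists>i. \<forall>s < zlen n + (t 1 - 1) * len n 0 + (len n 1 - 1). u (i + s) = u (i + len n 0 + s)"
proof -
  \<comment> \<open>\<phi>^p(0) ends with the letter p, and behind it stands \<phi>(0) = 0^(t_1) 1,
    the block of the 0 at position y.\<close>
  define x where "x = Pn p 1"
  define p' where "p' = p - 1"
  have p': "Suc p' = p" using p_pos by (simp add: p'_def)
  define y where "y = Pn p' 1"
  have xy: "x = P y" "u y = 0" using u_Pn_1[of p'] Pn_Suc[of p' 1] p' by (simp_all add: x_def y_def)
  have x: "x > 0" "u (x - 1) = p" using u_before_Pn_1[of p] m_pos by (simp_all add: x_def)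
  have z0: "u (x + i) = 0" if "i < t 1" for i using u_zero[of i y] xy that by simp
  have z1: "u (x + t 1) = 1" using u_end[of y] xy nxt_0 by simp
  have "u x = 0" using z0[of 0] t_one by simp
  then have "u (x - 1) \<noteq> u x" using x p_pos by simp
  from left_match_letters[OF this, of n] have "left_match (Pn n x) (Pn n (Suc x)) (left_len n p 0)"
    using x \<open>u x = 0\<close> by simp
  moreover have "left_len n p 0 = zlen n"
    using left_len_0[of p n] m_pos p_pos by (simp add: left_len_sym[of _ _ 0])
  ultimately obtain a b where ab: "Pn n x = a + 1 + zlen n" "Pn n (Suc x) = b + 1 + zlen n"
    "\<And>s. s < zlen n \<Longrightarrow> u (a + 1 + s) = u (b + 1 + s)" by (auto simp: left_match_def)
  let ?U = "len n 0"
  have b: "b = a + ?U" using ab(1,2) Pn_step[of n x] \<open>u x = 0\<close> by simp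
  have shift: "Pn n (x + d) = a + 1 + zlen n + d * ?U" if "d \<le> t 1" for d
    using Pn_add_zeros[of d x n] z0 that ab(1) by simp
  have "u (a + 1 + s) = u (a + 1 + ?U + s)"
    if s: "s < zlen n + (t 1 - 1) * ?U + (len n 1 - 1)" for s
  proof -
    consider "s < zlen n" | "zlen n \<le> s" "s < zlen n + (t 1 - 1) * ?U" | "zlen n + (t 1 - 1) * ?U \<le> s"
      by linarith
    then show ?thesis
    proof cases
      case 1
      then show ?thesis using ab(3)[of s] b by (simp add: add_ac)
    next
      case 2
      have "u (x + i) = u (Suc x + i)" if "i < t 1 - 1" for i
        using z0[of i] z0[of "Suc i"] that by simp
      note M = Pn_match[of "t 1 - 1" x "Suc x" n, OF this]
      define r where "r = s - zlen n"
      have "r < (t 1 - 1) * ?U" using 2 by (simp add: r_def)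
      then have "u (Pn n x + r) = u (Pn n (Suc x) + r)"
        using M shift[of "t 1 - 1"] ab(1) by simp
      moreover have "s = zlen n + r" using 2 by (simp add: r_def)
      ultimately show ?thesis using ab(1,2) b by (simp add: add_ac)
    next
      case 3
      define s' where "s' = s - (zlen n + (t 1 - 1) * ?U)"
      have s': "s = zlen n + (t 1 - 1) * ?U + s'" using 3 by (simp add: s'_def)
      have T: "t 1 * ?U = (t 1 - 1) * ?U + ?U" using t_one by (cases "t 1") auto
      \<comment> \<open>The last 0 of the run faces the letter 1, whose image agrees with that of 0
        up to its last letter.\<close>
      have "u (Pn n (x + (t 1 - 1)) + s') = u (Pn n (x + t 1) + s')"
      proof (rule right_match)
        show "lexge (u (x + (t 1 - 1))) (u (x + t 1))" using z0[of "t 1 - 1"] t_one lexge_0 by simp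
        show "s' + 1 < len n (u (x + t 1))" unfolding z1 using s s' by linarith
      qed
      then show ?thesis unfolding s' using shift[of "t 1 - 1"] shift[of "t 1"] T by (simp add: add_ac)
    qed
  qed
  then show ?thesis by blast
qed

lemma long_power:
  "\<exists>v w. is_factor v u \<and> is_factor w u \<and> is_power_of v w \<and> length w = len n 0 \<and>
     length v + 1 = t 1 * len n 0 + zlen n + len n 1"
proof -
  let ?U = "len n 0"
  define D where "D = zlen n + (t 1 - 1) * ?U + (len n 1 - 1)"
  obtain i where i: "\<And>s. s < D \<Longrightarrow> u (i + s) = u (i + ?U + s)" using long_match[of n] D_def by auto
  define v where "v = u [i \<rightarrow> i + (D + ?U)]"
  define w where "w = u [i \<rightarrow> i + ?U]"
  have lw: "length w = ?U" by (simp add: w_def)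
  then have wne: "w \<noteq> []" using len_pos[of n 0] by (metis length_0_conv less_irrefl)
  have per: "u (i + s) = u (i + s mod ?U)" if "s < D + ?U" for s
    using that
  proof (induction s rule: less_induct)
    case (less s)
    show ?case
    proof (cases "s < ?U")
      case False
      then have "u (i + s) = u (i + (s - ?U))" using i[of "s - ?U"] less.prems by (simp add: add_ac)
      also have "\<dots> = u (i + (s - ?U) mod ?U)" using False less.prems len_pos[of n 0]
        by (intro less.IH) linarith+
      also have "(s - ?U) mod ?U = s mod ?U" using False by (simp add: le_mod_geq)
      finally show ?thesis .
    qed simp
  qed
  have "v = w\<^sup>\<omega> [0 \<rightarrow> D + ?U]"
  proof (rule nth_equalityI)
    fix s assume "s < length v"
    then have s: "s < D + ?U" by (simp add: v_def)
    have "s mod ?U < ?U" by simp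
    then have "w ! (s mod ?U) = u (i + s mod ?U)" by (simp add: w_def)
    then show "v ! s = (w\<^sup>\<omega> [0 \<rightarrow> D + ?U]) ! s"
      using s per[OF s] wne by (simp add: v_def iter_def lw)
  qed (simp add: v_def)
  then have "is_power_of v w" using wne by (auto simp: is_power_of_def)
  moreover have "is_factor v u" "is_factor w u" unfolding is_factor_def v_def w_def
    using le_add1 by blast+
  moreover have "length v + 1 = t 1 * ?U + zlen n + len n 1"
  proof -
    have "t 1 * ?U = (t 1 - 1) * ?U + ?U" using t_one by (cases "t 1") auto
    then show ?thesis using len_pos[of n 1] by (simp add: v_def D_def)
  qed
  ultimately show ?thesis using lw by blast
qed


subsection \<open>The exponents\<close>

definition expo :: "nat \<Rightarrow> real" where
  "expo n = real (t 1) + (real (zlen n) + real (len n 1) - 1) / real (len n 0)"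

lemma expo_ge: "real (t 1) \<le> expo n"
proof -
  have "1 \<le> real (len n 1)" using len_pos[of n 1] by linarith
  then show ?thesis by (simp add: expo_def)
qed

lemma expo_0: "expo 0 = real (t 1)"
  using zlen_rec[of 0] m_pos by (simp add: expo_def)

lemma expo_eq: "length v + 1 = t 1 * len n 0 + zlen n + len n 1 \<Longrightarrow>
   real (length v) / real (len n 0) = expo n"
proof -
  assume "length v + 1 = t 1 * len n 0 + zlen n + len n 1"
  then have "real (length v) = real (t 1) * real (len n 0) + real (zlen n) + real (len n 1) - 1"
    by (simp flip: of_nat_mult of_nat_add)
  then show ?thesis using len_pos[of n 0] by (simp add: expo_def field_simps)
qed

lemma word_index_le:
  assumes hyp: "t 1 \<ge> 4 \<or> (t 1 = 3 \<and> \<not> p dvd z)"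
    and c: "real (t 1) \<le> c" "\<And>n. len n 0 = length w \<Longrightarrow> expo n \<le> c"
  shows "word_index u w \<le> ereal c"
  unfolding word_index_def
proof (rule SUP_least)
  fix v assume "v \<in> {v. is_factor v u \<and> is_power_of v w}"
  then have v: "is_factor v u" "is_power_of v w" by auto
  then have w: "length w > 0" by (auto simp: is_power_of_def)
  from power_bound[OF v hyp] show "ereal (real (length v) / real (length w)) \<le> ereal c"
  proof
    assume "length v \<le> t 1 * length w"
    then have "real (length v) \<le> real (t 1) * real (length w)" by (simp flip: of_nat_mult)
    then have "real (length v) / real (length w) \<le> real (t 1)" using w by (simp add: pos_divide_le_eq)
    then show ?thesis using c(1) by simp
  next
    assume "\<exists>n. length w = len n 0 \<and> length v + 1 \<le> t 1 * len n 0 + zlen n + len n 1"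
    then obtain n where n: "length w = len n 0" "length v + 1 \<le> t 1 * len n 0 + zlen n + len n 1" by blast
    then have "real (length v) + 1 \<le> real (t 1) * real (len n 0) + real (zlen n) + real (len n 1)"
      by (simp flip: of_nat_mult of_nat_add of_nat_Suc)
    then have "real (length v) / real (length w) \<le> expo n"
      using len_pos[of n 0] unfolding n(1) by (simp add: expo_def field_simps)
    then show ?thesis using c(2)[of n] n(1) by simp
  qed
qed

lemma word_index_ge: "\<exists>w. is_factor w u \<and> length w = len n 0 \<and> ereal (expo n) \<le> word_index u w"
proof -
  from long_power[of n] obtain v w where vw: "is_factor v u" "is_factor w u" "is_power_of v w"
    "length w = len n 0" "length v + 1 = t 1 * len n 0 + zlen n + len n 1" by blast
  have "ereal (real (length v) / real (length w)) \<le> word_index u w"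
    unfolding word_index_def by (rule SUP_upper) (use vw in auto)
  then show ?thesis using vw expo_eq[OF vw(5)] by auto
qed

lemma critical_exponent_eq:
  assumes hyp: "t 1 \<ge> 4 \<or> (t 1 = 3 \<and> \<not> p dvd z)"
  shows "critical_exponent u = (SUP n. ereal (expo n))"
proof (rule antisym)
  show "critical_exponent u \<le> (SUP n. ereal (expo n))"
    unfolding critical_exponent_def
  proof (rule SUP_least)
    fix w :: "nat list"
    \<comment> \<open>Inserting \<open>expo 0\<close>, which is t_1, keeps the set nonempty and the
      maximum at least t_1, as \<open>word_index_le\<close> demands.\<close>
    let ?c = "Max (insert (expo 0) (expo ` {n. len n 0 = length w}))"
    have sm: "strict_mono (\<lambda>n. len n 0)" using len_0_less by (simp add: strict_mono_Suc_iff)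
    have "finite {n. len n 0 = length w}"
    proof (rule finite_subset)
      show "{n. len n 0 = length w} \<subseteq> {..length w}"
      proof
        fix n assume "n \<in> {n. len n 0 = length w}"
        then show "n \<in> {..length w}" using strict_mono_imp_increasing[OF sm, of n] by simp
      qed
    qed simp
    then have fin: "finite (insert (expo 0) (expo ` {n. len n 0 = length w}))" by simp
    have "word_index u w \<le> ereal ?c"
      by (rule word_index_le[OF hyp]) (use fin expo_0 in \<open>auto intro!: Max_ge\<close>)
    also obtain n where "?c = expo n" using Max_in[OF fin] by blast
    then have "ereal ?c \<le> (SUP n. ereal (expo n))"
      using SUP_upper[of n UNIV "\<lambda>n. ereal (expo n)"] by simp
    finally show "word_index u w \<le> (SUP n. ereal (expo n))" .
  qed
  show "(SUP n. ereal (expo n)) \<le> critical_exponent u"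
  proof (rule SUP_least)
    fix n
    obtain w where w: "is_factor w u" "length w = len n 0" "ereal (expo n) \<le> word_index u w"
      using word_index_ge by blast
    have "w \<noteq> []" using w(2) len_pos[of n 0] by (metis length_0_conv less_irrefl)
    then have "word_index u w \<le> critical_exponent u"
      unfolding critical_exponent_def using w(1) by (intro SUP_upper) auto
    with w(3) show "ereal (expo n) \<le> critical_exponent u" by simp
  qed
qed

lemma finite_factors: "finite {w. is_factor w u \<and> length w = n}"
proof (rule finite_subset)
  show "{w. is_factor w u \<and> length w = n} \<subseteq> {w. set w \<subseteq> {..<m+p} \<and> length w = n}"
    by (auto simp: is_factor_def)
qed (simp add: finite_lists_length_eq)

lemma index_of_length_le:
  assumes hyp: "t 1 \<ge> 4 \<or> (t 1 = 3 \<and> \<not> p dvd z)"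
    and c: "real (t 1) \<le> c" "\<And>n. len n 0 = N \<Longrightarrow> expo n \<le> c"
  shows "index_of_length u N \<le> ereal c"
proof -
  have "u [0 \<rightarrow> N] \<in> {w. is_factor w u \<and> length w = N}" by (auto simp: is_factor_def)
  then show ?thesis unfolding index_of_length_def
    using finite_factors word_index_le[OF hyp] c by (subst Max_le_iff) auto
qed

lemma index_of_length_ge: "ereal (expo n) \<le> index_of_length u (len n 0)"
proof -
  obtain w where w: "is_factor w u" "length w = len n 0" "ereal (expo n) \<le> word_index u w"
    using word_index_ge by blast
  have "word_index u w \<le> index_of_length u (len n 0)"
    unfolding index_of_length_def using finite_factors w by (intro Max_ge) auto
  with w show ?thesis by simp
qed

lemma ultimate_critical_exponent_eq:
  assumes hyp: "t 1 \<ge> 4 \<or> (t 1 = 3 \<and> \<not> p dvd z)" and lim: "expo \<longlonglongrightarrow> e"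
  shows "ultimate_critical_exponent u = ereal e"
proof (rule antisym)
  have sm: "strict_mono (\<lambda>n. len n 0)" using len_0_less by (simp add: strict_mono_Suc_iff)
  have te: "real (t 1) \<le> e" using LIMSEQ_le_const[OF lim] expo_ge by blast
  show "ultimate_critical_exponent u \<le> ereal e"
    unfolding ultimate_critical_exponent_def
  proof (rule ereal_le_epsilon2)
    fix \<epsilon> :: real assume "\<epsilon> > 0"
    then have "\<forall>\<^sub>F n in sequentially. expo n < e + \<epsilon>" using lim by (intro order_tendstoD) auto
    then obtain n0 where n0: "\<And>n. n \<ge> n0 \<Longrightarrow> expo n < e + \<epsilon>" by (auto simp: eventually_sequentially)
    have "\<forall>\<^sub>F N in sequentially. index_of_length u N \<le> ereal (e + \<epsilon>)"
    proof (rule eventually_sequentiallyI)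
      fix N assume N: "len n0 0 \<le> N"
      show "index_of_length u N \<le> ereal (e + \<epsilon>)"
      \<comment> \<open>If N is not some |\<phi>^n(0)|, only t_1 <= e matters; otherwise N >=
        \<open>len n0 0\<close> forces n >= n0.\<close>
      proof (rule index_of_length_le[OF hyp])
        show "real (t 1) \<le> e + \<epsilon>" using te \<open>\<epsilon> > 0\<close> by simp
        fix n assume "len n 0 = N"
        then have "n0 \<le> n" using N strict_mono_less_eq[OF sm] by blast
        then show "expo n \<le> e + \<epsilon>" using n0 by fastforce
      qed
    qed
    then show "limsup (index_of_length u) \<le> ereal e + ereal \<epsilon>" by (simp add: Limsup_bounded)
  qed
  have "ereal e = limsup (\<lambda>n. ereal (expo n))"
    using lim by (intro lim_imp_Limsup[symmetric]) auto
  also have "\<dots> \<le> limsup (index_of_length u \<circ> (\<lambda>n. len n 0))"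
    by (rule Limsup_mono) (simp add: index_of_length_ge)
  also have "\<dots> \<le> limsup (index_of_length u)" by (rule limsup_subseq_mono[OF sm])
  finally show "ereal e \<le> ultimate_critical_exponent u" by (simp add: ultimate_critical_exponent_def)
qed


end


subsection \<open>Asymptotics\<close>

locale parry_base = parry_digits +
  fixes \<beta> :: real
  assumes beta_gt_1: "\<beta> > 1" and digit_sums: "(\<lambda>i. real (t (i + 1)) / \<beta> ^ (i + 1)) sums 1"
begin

abbreviation \<Delta> :: "nat \<Rightarrow> real" where "\<Delta> \<equiv> parry_delta \<beta> t"
abbreviation U :: "nat \<Rightarrow> real" where "U n \<equiv> real (len n 0)"

lemma t_1_le_beta: "real (t 1) \<le> \<beta>"
proof -
  have "(\<Sum>i<1. real (t (i + 1)) / \<beta> ^ (i + 1)) \<le> (\<Sum>i. real (t (i + 1)) / \<beta> ^ (i + 1))"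
    using beta_gt_1 digit_sums by (intro sum_le_suminf) (auto simp: sums_iff)
  then show ?thesis using digit_sums beta_gt_1 by (simp add: sums_iff)
qed

lemma beta_ge_3: "\<beta> \<ge> 3"
  using t_1_le_beta t_one by linarith

lemma bound_sums: "(\<lambda>i. real (t 1) / \<beta> ^ (i + 1)) sums (real (t 1) / (\<beta> - 1))"
proof -
  have "(\<lambda>i. (1 / \<beta>) ^ i) sums (1 / (1 - 1 / \<beta>))"
    using beta_gt_1 by (intro geometric_sums) simp
  then have "(\<lambda>i. real (t 1) / \<beta> * (1 / \<beta>) ^ i) sums (real (t 1) / \<beta> * (1 / (1 - 1 / \<beta>)))"
    by (rule sums_mult)
  moreover have "\<beta> * (1 - 1 / \<beta>) = \<beta> - 1" using beta_gt_1 by (simp add: field_simps)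
  ultimately show ?thesis by (simp add: power_divide)
qed

lemma digit_bound: "0 \<le> real (t (i + 1 + k)) / \<beta> ^ (i + 1)" 
  "real (t (i + 1 + k)) / \<beta> ^ (i + 1) \<le> real (t 1) / \<beta> ^ (i + 1)"
  using beta_gt_1 t_le[of "i + 1 + k"] by (auto intro!: divide_right_mono)

lemma delta_summable: "summable (\<lambda>i. real (t (i + 1 + k)) / \<beta> ^ (i + 1))"
proof (rule summable_comparison_test')
  show "summable (\<lambda>i. real (t 1) / \<beta> ^ (i + 1))" using bound_sums by (rule sums_summable)
  show "norm (real (t (n + 1 + k)) / \<beta> ^ (n + 1)) \<le> real (t 1) / \<beta> ^ (n + 1)" if "n \<ge> 0" for n
    using digit_bound[of n k] by simp
qed

lemma delta_ge_0: "0 \<le> \<Delta> k"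
  unfolding parry_delta_def by (rule suminf_nonneg[OF delta_summable digit_bound(1)])

lemma delta_le: "\<Delta> k \<le> 3 / 2"
proof -
  have "\<Delta> k \<le> real (t 1) / (\<beta> - 1)"
    unfolding parry_delta_def sums_unique[OF bound_sums]
    using delta_summable digit_bound(2) bound_sums by (intro suminf_le) (auto simp: sums_iff)
  \<comment> \<open>t_1 <= \<beta>, and \<beta> / (\<beta> - 1) decreases in \<beta> with value 3/2
    at 3.\<close>
  also have "\<dots> \<le> 3 / 2" using t_1_le_beta beta_ge_3 by (simp add: field_simps)
  finally show ?thesis .
qed

lemma delta_0: "\<Delta> 0 = 1"
  using digit_sums by (simp add: parry_delta_def sums_iff)

lemma delta_rec: "\<beta> * \<Delta> k = real (t (k + 1)) + \<Delta> (k + 1)"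
proof -
  let ?f = "\<lambda>i. real (t (i + 1 + k)) / \<beta> ^ (i + 1)"
  have "\<Delta> k = (\<Sum>i. ?f (Suc i)) + ?f 0"
    unfolding parry_delta_def using suminf_split_head[OF delta_summable[of k]] by simp
  moreover have "(\<Sum>i. ?f (Suc i)) = (\<Sum>i. (1 / \<beta>) * (real (t (i + 1 + (k + 1))) / \<beta> ^ (i + 1)))"
    by (simp add: mult.commute)
  moreover have "\<dots> = (1 / \<beta>) * \<Delta> (k + 1)"
    unfolding parry_delta_def by (rule suminf_mult[OF delta_summable])
  ultimately show ?thesis using beta_gt_1 by (simp add: field_simps)
qed

lemma delta_nxt: "a < m + p \<Longrightarrow> \<Delta> (nxt a) = \<Delta> (a + 1)"
  using nxt_seq[of a] by (simp add: parry_delta_def add_ac)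

lemma delta_1: "\<Delta> 1 = \<beta> - real (t 1)"
  using delta_rec[of 0] delta_0 by simp

text \<open>
  Passing from \<open>n\<close> to \<open>n + 1\<close> adds \<open>\<Delta> a \<le> 3/2\<close> times the error for the letter \<open>1\<close> to the error for the
  next letter, whence the growth rate \<open>5/2\<close>, which is smaller than that of \<open>U\<close> because \<open>t\<^sub>1 \<ge> 3\<close>.
\<close>

lemma len_approx: "a < m + p \<Longrightarrow> \<bar>real (len n a) - \<Delta> a * U n\<bar> \<le> (5 / 2) ^ n"
proof (induction n arbitrary: a)
  case 0
  show ?case using delta_ge_0[of a] delta_le[of a] by simp
next
  case (Suc n)
  \<comment> \<open>Writing \<beta> = t_1 + \<open>\<Delta> 1\<close> expresses the digit through
    the deltas, so that the main terms cancel against the recursion of U.\<close>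
  have "\<Delta> a * \<beta> = \<Delta> a * real (t 1) + \<Delta> a * \<Delta> 1"
    unfolding delta_1 by (simp add: algebra_simps)
  then have ta: "real (t (a + 1)) = \<Delta> a * real (t 1) + \<Delta> a * \<Delta> 1 - \<Delta> (nxt a)"
    using delta_rec[of a] delta_nxt[OF Suc.prems] by (simp add: mult.commute[of \<beta>])
  have "real (len (Suc n) a) = real (t (a + 1)) * U n + real (len n (nxt a))"
    "U (Suc n) = real (t 1) * U n + real (len n 1)"
    using nxt_0 by simp_all
  then have eq: "real (len (Suc n) a) - \<Delta> a * U (Suc n) =
     (real (len n (nxt a)) - \<Delta> (nxt a) * U n) - \<Delta> a * (real (len n 1) - \<Delta> 1 * U n)"
    unfolding ta by (simp only:) (simp add: algebra_simps)
  have "1 < m + p" using m_pos p_pos by simp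
  then have "\<bar>\<Delta> a * (real (len n 1) - \<Delta> 1 * U n)\<bar> \<le> 3 / 2 * (5 / 2) ^ n"
    unfolding abs_mult using Suc.IH[of 1] delta_ge_0[of a] delta_le[of a] by (intro mult_mono) auto
  moreover have "(5 / 2 :: real) ^ Suc n = 5 / 2 * (5 / 2) ^ n" by simp
  ultimately show ?case using Suc.IH[OF nxt_lt, of a] unfolding eq by linarith
qed

lemma U_ge: "3 ^ n \<le> U n"
proof (induction n)
  case (Suc n)
  have "3 ^ Suc n \<le> 3 * U n" unfolding power_Suc by (rule mult_left_mono[OF Suc.IH]) simp
  also have "3 * U n \<le> real (t 1) * U n" using t_one by (intro mult_right_mono) auto
  also have "\<dots> \<le> U (Suc n)" by simp
  finally show ?case .
qed simp

lemma U_shift: "\<exists>C\<ge>0. \<forall>k. \<bar>U (k + i) - \<beta> ^ i * U k\<bar> \<le> C * (5 / 2) ^ k"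
proof (induction i)
  case (Suc i)
  then obtain C where C: "C \<ge> 0" "\<And>k. \<bar>U (k + i) - \<beta> ^ i * U k\<bar> \<le> C * (5 / 2) ^ k" by blast
  have "\<bar>U (k + Suc i) - \<beta> ^ Suc i * U k\<bar> \<le> ((5 / 2) ^ i + \<beta> * C) * (5 / 2) ^ k" for k
  proof -
    have "U (k + Suc i) = real (t 1) * U (k + i) + real (len (k + i) 1)" using nxt_0 by simp
    then have "U (k + Suc i) - \<beta> ^ Suc i * U k =
       (real (len (k + i) 1) - \<Delta> 1 * U (k + i)) + \<beta> * (U (k + i) - \<beta> ^ i * U k)"
      unfolding delta_1 by (simp add: algebra_simps)
    moreover have "\<bar>real (len (k + i) 1) - \<Delta> 1 * U (k + i)\<bar> \<le> (5 / 2) ^ (k + i)"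
      using m_pos p_pos by (intro len_approx) simp
    moreover have "\<bar>\<beta> * (U (k + i) - \<beta> ^ i * U k)\<bar> \<le> \<beta> * (C * (5 / 2) ^ k)"
      unfolding abs_mult using beta_gt_1 C(2)[of k] by (simp add: mult_left_mono)
    ultimately have "\<bar>U (k + Suc i) - \<beta> ^ Suc i * U k\<bar> \<le> (5 / 2) ^ (k + i) + \<beta> * (C * (5 / 2) ^ k)"
      by linarith
    then show ?thesis by (simp add: algebra_simps power_add)
  qed
  moreover have "(5 / 2) ^ i + \<beta> * C \<ge> 0" using C(1) beta_gt_1 by simp
  ultimately show ?case by blast
qed auto

lemma wlen_approx: "\<bar>real (wlen n) - (real tm + \<Delta> m) * U n\<bar> \<le> (5 / 2) ^ n"
  using len_approx[of m n] p_pos by (simp add: wlen_def algebra_simps)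

text \<open>The error (5/2)^n is divided by U n >= 3^n, which leaves the null sequence
  (5/6)^n.\<close>

lemma ratio_limit:
  assumes "\<And>n. \<bar>f n - c * U n\<bar> \<le> C * (5 / 2) ^ n"
  shows "(\<lambda>n. f n / U n) \<longlonglongrightarrow> c"
proof -
  have "(\<lambda>n. f n / U n - c) \<longlonglongrightarrow> 0"
  proof (rule Lim_null_comparison)
    show "\<forall>\<^sub>F n in sequentially. norm (f n / U n - c) \<le> \<bar>C\<bar> * (5 / 6) ^ n"
    proof (intro always_eventually allI)
      fix n
      have "f n / U n - c = (f n - c * U n) / U n" using len_pos[of n 0] by (simp add: field_simps)
      then have "norm (f n / U n - c) = \<bar>f n - c * U n\<bar> / U n" by simp
      also have "\<dots> \<le> (\<bar>C\<bar> * (5 / 2) ^ n) / 3 ^ n"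
        using assms[of n] U_ge[of n] by (intro frac_le) (auto intro: order_trans mult_right_mono)
      also have "\<dots> = \<bar>C\<bar> * (5 / 6) ^ n" using power_divide[of "5 / 2 :: real" 3 n] by simp
      finally show "norm (f n / U n - c) \<le> \<bar>C\<bar> * (5 / 6) ^ n" .
    qed
    show "(\<lambda>n. \<bar>C\<bar> * (5 / 6) ^ n) \<longlonglongrightarrow> (0 :: real)"
      by (intro tendsto_mult_right_zero LIMSEQ_power_zero) simp
  qed
  then show ?thesis by (simp add: LIM_zero_iff)
qed

text \<open>The limit of |z^(n)| / U n: the fixed point of \<open>zlen_rec\<close> when U (k + m) is
  replaced by \<beta>^m U k.\<close>

definition zlim :: real where
  "zlim = (real tm + \<Delta> m) / (if p dvd z then \<beta> ^ m - 1 else \<beta> ^ m)"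

lemma zlen_approx: "\<exists>C. \<forall>n. \<bar>real (zlen n) - zlim * U n\<bar> \<le> C * (5 / 2) ^ n"
proof -
  define D :: real where "D = (if p dvd z then 1 else 0)"
  have bm: "\<beta> ^ m > 1" using beta_gt_1 m_pos by (intro one_less_power) auto
  have zl: "zlim * \<beta> ^ m = real tm + \<Delta> m + D * zlim"
  proof -
    have "\<beta> ^ m \<noteq> 0" "\<beta> ^ m - 1 \<noteq> 0" using bm by linarith+
    then show ?thesis by (auto simp: zlim_def D_def field_simps)
  qed
  have z0: "zlim \<ge> 0" using bm delta_ge_0[of m] by (simp add: zlim_def)
  obtain C where C: "C \<ge> 0" "\<And>k. \<bar>U (k + m) - \<beta> ^ m * U k\<bar> \<le> C * (5 / 2) ^ k"
    using U_shift[of m] by blast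
  \<comment> \<open>The second entry covers n < m. The first makes 1 + zlim * C + B <= 2 B <= (5/2)
    B, and m >= 1 supplies the factor 5/2 in the induction step.\<close>
  define B where "B = max (1 + zlim * C) (zlim * U m)"
  have B: "1 + zlim * C \<le> B" "zlim * U m \<le> B" "B \<ge> 0" using z0 by (auto simp: B_def le_max_iff_disj)
  have "\<bar>real (zlen n) - zlim * U n\<bar> \<le> B * (5 / 2) ^ n" for n
  proof (induction n rule: less_induct)
    case (less n)
    show ?case
    proof (cases "n < m")
      case True
      have "zlim * U n \<le> zlim * U m" using z0 True by (intro mult_left_mono) (auto intro: len_mono)
      also have "\<dots> \<le> B * (5 / 2) ^ n"
        using mult_mono[OF B(2) one_le_power[of "5/2 :: real" n] B(3)] by simp
      finally show ?thesis using True z0 zlen_rec[of n] by simp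
    next
      case False
      define k where "k = n - m"
      have n: "n = k + m" "k < n" using False m_pos by (auto simp: k_def)
      have "real (zlen n) = real (wlen k) + D * real (zlen k)"
        using False by (subst zlen_rec) (simp add: D_def k_def)
      then have "real (zlen n) - zlim * U n = (real (wlen k) - (real tm + \<Delta> m) * U k)
         + D * (real (zlen k) - zlim * U k) - zlim * (U (k + m) - \<beta> ^ m * U k)"
        using zl unfolding n(1) by (simp add: algebra_simps) (metis distrib_right mult.assoc)
      moreover have "\<bar>D * (real (zlen k) - zlim * U k)\<bar> \<le> B * (5 / 2) ^ k"
        using less.IH[OF n(2)] B(3) by (simp add: D_def)
      moreover have "\<bar>zlim * (U (k + m) - \<beta> ^ m * U k)\<bar> \<le> zlim * (C * (5 / 2) ^ k)"
        unfolding abs_mult using z0 C(2)[of k] by (simp add: mult_left_mono)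
      ultimately have "\<bar>real (zlen n) - zlim * U n\<bar> \<le>
          (5 / 2) ^ k + B * (5 / 2) ^ k + zlim * (C * (5 / 2) ^ k)"
        using wlen_approx[of k] by linarith
      also have "\<dots> = (1 + zlim * C + B) * (5 / 2) ^ k" by (simp add: algebra_simps)
      also have "\<dots> \<le> (B * (5 / 2)) * (5 / 2) ^ k" using B by (intro mult_right_mono) auto
      also have "\<dots> = B * (5 / 2) ^ Suc k" by simp
      also have "\<dots> \<le> B * (5 / 2) ^ n" using B n by (intro mult_left_mono power_increasing) auto
      finally show ?thesis .
    qed
  qed
  then show ?thesis by blast
qed

lemma expo_limit: "expo \<longlonglongrightarrow> \<beta> + zlim"
proof -
  obtain C where "\<And>n. \<bar>real (zlen n) - zlim * U n\<bar> \<le> C * (5 / 2) ^ n" using zlen_approx by blast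
  then have 1: "(\<lambda>n. real (zlen n) / U n) \<longlonglongrightarrow> zlim" by (rule ratio_limit)
  have "\<bar>real (len n 1) - \<Delta> 1 * U n\<bar> \<le> 1 * (5 / 2) ^ n" for n
    using len_approx[of 1 n] m_pos p_pos by simp
  then have 2: "(\<lambda>n. real (len n 1) / U n) \<longlonglongrightarrow> \<Delta> 1" by (rule ratio_limit)
  have "\<bar>1 - 0 * U n\<bar> \<le> 1 * (5 / 2) ^ n" for n by simp
  then have 3: "(\<lambda>n. 1 / U n) \<longlonglongrightarrow> 0" by (rule ratio_limit)
  have "(\<lambda>n. real (t 1) + (real (zlen n) / U n + real (len n 1) / U n - 1 / U n))
      \<longlonglongrightarrow> real (t 1) + (zlim + \<Delta> 1 - 0)"
    by (intro tendsto_intros 1 2 3)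
  moreover have "expo = (\<lambda>n. real (t 1) + (real (zlen n) / U n + real (len n 1) / U n - 1 / U n))"
    by (simp add: expo_def fun_eq_iff diff_divide_distrib add_divide_distrib)
  moreover have "real (t 1) + (zlim + \<Delta> 1 - 0) = \<beta> + zlim" using delta_1 by simp
  ultimately show ?thesis by (simp only:)
qed

end


subsection \<open>The theorem\<close>

lemma parry_base_of_non_simple_parry:
  assumes "non_simple_parry \<beta> t m p" "t 1 \<ge> 3"
  shows "parry_base t m p \<beta>"
proof -
  have beta: "\<beta> > 1" and sums: "(\<lambda>i. real (t (i + 1)) / \<beta> ^ (i + 1)) sums 1"
    and lex: "\<And>i. i \<ge> 2 \<Longrightarrow> less_fun (\<lambda>j. t (i + j)) (\<lambda>j. t (1 + j))"
    and nz: "\<not> (\<exists>k. \<forall>i>k. t i = 0)"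
    and mp: "m \<ge> 1" "p \<ge> 1" and per: "\<And>i. i > m \<Longrightarrow> t (i + p) = t i"
    and min: "\<And>m' p'. has_preperiod_period t m' p' \<Longrightarrow> m \<le> m' \<and> p \<le> p'"
    using assms(1) by (auto simp: non_simple_parry_def renyi_expansion_of_one_def has_preperiod_period_def)
  have neq: "t m \<noteq> t (m + p)"
  proof
    assume eq: "t m = t (m + p)"
    have per': "t (i + p) = t i" if "i \<ge> m" for i using per[of i] eq that by (cases "i = m") auto
    show False
    proof (cases "m = 1")
      \<comment> \<open>Minimality of m cannot be invoked at m = 1; instead t would be purely
        periodic and equal to its shift by p, against the strict lexicographic condition.\<close>
      case True
      then have "t (1 + p + j) = t (1 + j)" for j using per'[of "1 + j"] by (simp add: add_ac)
      then show False using lex[of "1 + p"] mp by (auto simp: less_fun_nat_iff)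
    next
      case False
      then have "has_preperiod_period t (m - 1) p" using mp per' by (auto simp: has_preperiod_period_def)
      from min[OF this] show False using mp by auto
    qed
  qed
  have "\<exists>i\<in>{m+1..m+p}. t i \<noteq> 0"
  proof (rule ccontr)
    assume *: "\<not> ?thesis"
    have "t i = 0" if "i > m" for i
      using that
    proof (induction i rule: less_induct)
      case (less i)
      show ?case
      proof (cases "i \<le> m + p")
        case False
        then have "t (i - p) = 0" using less.IH[of "i - p"] mp by simp
        then show ?thesis using per[of "i - p"] False by simp
      qed (use * less.prems in auto)
    qed
    with nz show False by blast
  qed
  with beta sums lex mp per neq assms(2) show ?thesis by unfold_locales auto
qed

theorem theorem5p1:
  fixes \<beta> :: real and t :: "nat \<Rightarrow> nat" and m p :: nat
  assumes "non_simple_parry \<beta> t m p"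
    and "t 1 \<ge> 4 \<or> (t 1 = 3 \<and> \<not> p dvd z_letter t m p)"
  shows "critical_exponent (u_parry t m p) =
           (SUP n. ereal (real (t 1) +
              (real (length (z_word t m p n)) + real (length ((parry_subst t m p ^^ n) [1])) - 1)
                / real (length ((parry_subst t m p ^^ n) [0]))))
       \<and> ultimate_critical_exponent (u_parry t m p) =
           ereal (if p dvd z_letter t m p
                  then \<beta> + 1 / (\<beta> ^ m - 1) * (real (t_min t m p) + parry_delta \<beta> t m)
                  else \<beta> + 1 / \<beta> ^ m * (real (t_min t m p) + parry_delta \<beta> t m))"
proof -
  interpret parry_base t m p \<beta>
    by (rule parry_base_of_non_simple_parry) (use assms in auto)
  have l: "length ((parry_subst t m p ^^ n) [1]) = len n 1"
    "length ((parry_subst t m p ^^ n) [0]) = len n 0" for n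
    using length_subst_pow_single[of 1 n] length_subst_pow_single[of 0 n] m_pos p_pos by auto
  show ?thesis
    using critical_exponent_eq[OF assms(2)] ultimate_critical_exponent_eq[OF assms(2) expo_limit]
    unfolding l expo_def zlim_def by simp
qed

end
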